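(* If $(G_n)_n$ is a sequence of finite graphs with uniformly bounded degree, then the combinatorial cost of the sequence is the infimum, over all non-principal ultrafilters $\mathfrak u$ on $\mathbb N$, of the costs of the ultraproduct groupoids $\mathcal G_{\mathfrak u}$ associated with the sequence: $$c\mathcal C((G_n)_n)=\inf\{\mathcal C(\mathcal G_{\mathfrak u}):\mathfrak u\text{ non-principal ultrafilter}\}.$$
   Context: Combinatorial cost (Elek). For a finite graph $G$ with vertex set $V$ and $L\in\mathbb N$, let $\mathcal C_L(G)$ be the infimum of $|E(H)|/|V|$ over all graphs $H$ with vertex set $V$ that are $L$-Lipschitz equivalent to $G$, i.e. the endpoints of every edge of $H$ are at distance at most $L$ in $G$ and the endpoints of every edge of $G$ are at distance at most $L$ in $H$. Then $c\mathcal C((G_n)_n):=\inf_{L}\liminf_{n\to\infty}\mathcal C_L(G_n)$. Ultraproduct groupoid. Let $X_n$ be the vertex set of $G_n$ with the uniform probability measure $\mu_n$ and $d_n$ the graph distance on $G_n$ ($+\infty$ between different components). $X_{\mathfrak u}$ is the ultraproduct $\prod_nX_n/\!\sim_{\mathfrak u}$ (sequences identified if equal for $\mathfrak u$-almost every $n$), with the Loeb probability measure $\mu_{\mathfrak u}$: $\mu_{\mathfrak u}([A_n]_{\mathfrak u})=\lim_{n\in\mathfrak u}\mu_n(A_n)$ for $A_n\subset X_n$, every measurable set being of the form $[A_n]_{\mathfrak u}$ up to a null set. $\mathcal G_{\mathfrak u}$ is the p.m.p. equivalence relation on $X_{\mathfrak u}$ $$\mathcal G_{\mathfrak u}=\{([x_n]_{\mathfrak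 u},[y_n]_{\mathfrak u}):\lim_{n\in\mathfrak u}d_n(x_n,y_n)<\infty\},$$ viewed as a groupoid, whose measure structure is characterized by: whenever $E_n\subset X_n\times X_n$ and $\sup_n\sup_{(x,y)\in E_n}d_n(x,y)<\infty$, the set $[E_n]_{\mathfrak u}$ is measurable, carries the Loeb measure structure, and has measure $\tilde\mu_{\mathfrak u}([E_n]_{\mathfrak u})=\lim_{n\in\mathfrak u}|E_n|/|X_n|$. (It is the ultraproduct of the equivalence relations generated by the graphs $G_n$, endowed with graphings consisting of a uniformly bounded number of partial bijections covering the edges.) Cost. A bisection of $\mathcal G_{\mathfrak u}$ is a measurable subset $\varphi\subset\mathcal G_{\mathfrak u}$ on which both coordinate projections are injective. A graphing is an at most countable family $\Phi=(\varphi_i)_i$ of bisections, with cost $\mathcal C(\Phi)=\sum_i\tilde\mu_{\mathfrak u}(\varphi_i)$. It is generating if the smallest equivalence relation containing all $\varphi_i$ is $\mathcal G_{\mathfrak u}$ (up to null sets). $\mathcal C(\mathcal G_{\mathfrak u})$ is the infimum of the costs of the generating graphings. *)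

theory Defs
  imports "HOL-Analysis.Analysis"
begin

subsection \<open>Finite simple graphs and combinatorial cost\<close>

definition finite_graph :: "'a set \<Rightarrow> 'a set set \<Rightarrow> bool" where
  "finite_graph V E \<longleftrightarrow> finite V \<and> V \<noteq> {} \<and> (\<forall>e\<in>E. e \<subseteq> V \<and> card e = 2)"

definition bounded_degree :: "(nat \<Rightarrow> 'a set) \<Rightarrow> (nat \<Rightarrow> 'a set set) \<Rightarrow> bool" where
  "bounded_degree V E \<longleftrightarrow> (\<exists>D. \<forall>n. \<forall>x\<in>V n. card {y. {x, y} \<in> E n} \<le> D)"

text \<open>Least length of a walk; \<open>\<infinity>\<close> (the infimum of the empty set) between different components.\<close>

definition gdist :: "'a set set \<Rightarrow> 'a \<Rightarrow> 'a \<Rightarrow> enat" where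
  "gdist E x y = (INF k\<in>{k. (x, y) \<in> {(u, v). {u, v} \<in> E} ^^ k}. enat k)"

definition lipschitz_equivalent :: "nat \<Rightarrow> 'a set set \<Rightarrow> 'a set set \<Rightarrow> bool" where
  "lipschitz_equivalent L E F \<longleftrightarrow>
     (\<forall>x y. {x, y} \<in> F \<longrightarrow> gdist E x y \<le> enat L) \<and>
     (\<forall>x y. {x, y} \<in> E \<longrightarrow> gdist F x y \<le> enat L)"

text \<open>The value is \<open>\<infinity>\<close> if there is no admissible graph, which happens only for \<open>L = 0\<close>.\<close>

definition cost_at_scale :: "nat \<Rightarrow> 'a set \<Rightarrow> 'a set set \<Rightarrow> ennreal" where
  "cost_at_scale L V E =
     (INF F\<in>{F. finite_graph V F \<and> lipschitz_equivalent L E F}.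
        ennreal (real (card F) / real (card V)))"

definition combinatorial_cost :: "(nat \<Rightarrow> 'a set) \<Rightarrow> (nat \<Rightarrow> 'a set set) \<Rightarrow> ennreal" where
  "combinatorial_cost V E = (INF L. liminf (\<lambda>n. cost_at_scale L (V n) (E n)))"


subsection \<open>Ultrafilters and ultraproducts\<close>

definition ultrafilter :: "'i filter \<Rightarrow> bool" where
  "ultrafilter U \<longleftrightarrow>
     U \<noteq> bot \<and> (\<forall>P. eventually P U \<or> eventually (\<lambda>i. \<not> P i) U)"

definition nonprincipal_ultrafilter :: "'i filter \<Rightarrow> bool" where
  "nonprincipal_ultrafilter U \<longleftrightarrow> ultrafilter U \<and> (\<forall>i. U \<noteq> principal {i})"

definition ultra_rel ::
    "nat filter \<Rightarrow> (nat \<Rightarrow> 'a set) \<Rightarrow> ((nat \<Rightarrow> 'a) \<times> (nat \<Rightarrow> 'a)) set" where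
  "ultra_rel U V =
     {(x, y). x \<in> Pi UNIV V \<and> y \<in> Pi UNIV V \<and> eventually (\<lambda>n. x n = y n) U}"

definition ultra_class ::
    "nat filter \<Rightarrow> (nat \<Rightarrow> 'a set) \<Rightarrow> (nat \<Rightarrow> 'a) \<Rightarrow> (nat \<Rightarrow> 'a) set" where
  "ultra_class U V x = ultra_rel U V `` {x}"

definition ultraproduct :: "nat filter \<Rightarrow> (nat \<Rightarrow> 'a set) \<Rightarrow> (nat \<Rightarrow> 'a) set set" where
  "ultraproduct U V = Pi UNIV V // ultra_rel U V"

text \<open>The set \<open>[S\<^sub>n]\<close> for \<open>S\<^sub>n \<subseteq> V\<^sub>n \<times> V\<^sub>n\<close>, with the ultraproduct of the \<open>V\<^sub>n \<times> V\<^sub>n\<close> identified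
  with the square of the ultraproduct of the \<open>V\<^sub>n\<close>.\<close>

definition internal_rel ::
    "nat filter \<Rightarrow> (nat \<Rightarrow> 'a set) \<Rightarrow> (nat \<Rightarrow> ('a \<times> 'a) set)
      \<Rightarrow> ((nat \<Rightarrow> 'a) set \<times> (nat \<Rightarrow> 'a) set) set" where
  "internal_rel U V S =
     {(ultra_class U V x, ultra_class U V y) | x y.
        x \<in> Pi UNIV V \<and> y \<in> Pi UNIV V \<and> eventually (\<lambda>n. (x n, y n) \<in> S n) U}"


subsection \<open>The ultraproduct groupoid\<close>

definition ultra_groupoid ::
    "nat filter \<Rightarrow> (nat \<Rightarrow> 'a set) \<Rightarrow> (nat \<Rightarrow> 'a set set)
      \<Rightarrow> ((nat \<Rightarrow> 'a) set \<times> (nat \<Rightarrow> 'a) set) set" where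
  "ultra_groupoid U V E =
     {(ultra_class U V x, ultra_class U V y) | x y.
        x \<in> Pi UNIV V \<and> y \<in> Pi UNIV V \<and> Lim U (\<lambda>n. gdist (E n) (x n) (y n)) < \<infinity>}"

definition uniform_subrels ::
    "(nat \<Rightarrow> 'a set) \<Rightarrow> (nat \<Rightarrow> 'a set set) \<Rightarrow> (nat \<Rightarrow> ('a \<times> 'a) set) set" where
  "uniform_subrels V E =
     {S. (\<forall>n. S n \<subseteq> V n \<times> V n) \<and> (SUP n. SUP (x, y)\<in>S n. gdist (E n) x y) < \<infinity>}"

text \<open>The Loeb construction: the complete measure on the groupoid that is generated by the internal
  sets \<open>[S\<^sub>n]\<close> of uniformly bounded distance and gives them mass \<open>lim |S\<^sub>n| / |V\<^sub>n|\<close>. These sets form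
  a ring, and the groupoid is a countable union of such sets of finite mass (in bounded degree),
  so the extension is unique. A subset of the unit space has as its Loeb measure the mass of the
  corresponding part of the diagonal.\<close>

definition ultra_groupoid_measure ::
    "nat filter \<Rightarrow> (nat \<Rightarrow> 'a set) \<Rightarrow> (nat \<Rightarrow> 'a set set)
      \<Rightarrow> ((nat \<Rightarrow> 'a) set \<times> (nat \<Rightarrow> 'a) set) measure" where
  "ultra_groupoid_measure U V E =
     completion (extend_measure (ultra_groupoid U V E) (uniform_subrels V E) (internal_rel U V)
       (\<lambda>S. Lim U (\<lambda>n. ennreal (real (card (S n)) / real (card (V n))))))"


subsection \<open>Cost\<close>

text \<open>Below, \<open>X\<close> is the unit space of the equivalence relation \<open>space M\<close>, and \<open>M\<close> is the measure
  on the relation itself.\<close>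

definition bisection :: "('x \<times> 'x) measure \<Rightarrow> ('x \<times> 'x) set \<Rightarrow> bool" where
  "bisection M \<phi> \<longleftrightarrow> \<phi> \<in> sets M \<and> inj_on fst \<phi> \<and> inj_on snd \<phi>"

text \<open>Finite families are covered: the empty set is a bisection of mass 0.\<close>

definition graphing :: "('x \<times> 'x) measure \<Rightarrow> (nat \<Rightarrow> ('x \<times> 'x) set) \<Rightarrow> bool" where
  "graphing M \<Phi> \<longleftrightarrow> (\<forall>i. bisection M (\<Phi> i))"

definition graphing_cost :: "('x \<times> 'x) measure \<Rightarrow> (nat \<Rightarrow> ('x \<times> 'x) set) \<Rightarrow> ennreal" where
  "graphing_cost M \<Phi> = (\<Sum>i. emeasure M (\<Phi> i))"

definition generated_equiv :: "'x set \<Rightarrow> (nat \<Rightarrow> ('x \<times> 'x) set) \<Rightarrow> ('x \<times> 'x) set" where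
  "generated_equiv X \<Phi> = \<Inter>{R. equiv X R \<and> (\<forall>i. \<Phi> i \<subseteq> R)}"

definition generating :: "'x set \<Rightarrow> ('x \<times> 'x) measure \<Rightarrow> (nat \<Rightarrow> ('x \<times> 'x) set) \<Rightarrow> bool" where
  "generating X M \<Phi> \<longleftrightarrow> sym_diff (generated_equiv X \<Phi>) (space M) \<in> null_sets M"

definition cost :: "'x set \<Rightarrow> ('x \<times> 'x) measure \<Rightarrow> ennreal" where
  "cost X M = (INF \<Phi>\<in>{\<Phi>. graphing M \<Phi> \<and> generating X M \<Phi>}. graphing_cost M \<Phi>)"

definition ultra_groupoid_cost ::
    "nat filter \<Rightarrow> (nat \<Rightarrow> 'a set) \<Rightarrow> (nat \<Rightarrow> 'a set set) \<Rightarrow> ennreal" where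
  "ultra_groupoid_cost U V E = cost (ultraproduct U V) (ultra_groupoid_measure U V E)"

end

theory Submission
  imports Defs
begin

text \<open>A measurable subset of the groupoid of bounded length is contained in an internal set of almost
  the same measure, by outer regularity and countable saturation. A graphing can thus be enlarged
  to countably many internal relations at almost no cost. Up to small measure, the edges of the
  \<open>G\<^sub>n\<close> are products of boundedly many steps along finitely many of these relations;
  adding the exceptional edges gives graphs Lipschitz equivalent to \<open>G\<^sub>n\<close> for almost all \<open>n\<close>.
  Conversely, take an ultrafilter concentrated on indices where the cost at scale \<open>L\<close> is almost
  the lower limit, and near-optimal graphs there. Having bounded degree, they split into boundedly
  many partial injections, whose ultraproducts form a generating graphing.\<close>

subsection \<open>Ultrafilters\<close>

text \<open>Only internal relations descend to the finite graphs, and they are closed under finite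
  unions only. A graphing is countable, measurable for a completed sigma-algebra, and generates only
  up to a null set, so it has to be truncated: to distance balls, to finitely many relations, to
  boundedly many steps. Each truncation costs arbitrarily little because balls have finite mass;
  this is one use of bounded degree, the other being the bounded number of colours in the converse
  direction. What survives is finite, so one Lipschitz constant serves almost every index, as the
  infimum over \<open>L\<close> outside the lower limit demands. Ultrafilters enter through an
  infimum because a limit along one is never below the lower limit, while a suitable one comes as
  close to it as desired.\<close>

lemma ultrafilterD: "ultrafilter U \<Longrightarrow> eventually P U \<or> eventually (\<lambda>i. \<not> P i) U"
  by (simp add: ultrafilter_def)

lemma ultrafilter_eventually_not:
  assumes "ultrafilter U"
  shows "eventually (\<lambda>i. \<not> P i) U \<longleftrightarrow> \<not> eventually P U"
proof
  assume "eventually (\<lambda>i. \<not> P i) U"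
  show "\<not> eventually P U"
  proof
    assume "eventually P U"
    with \<open>eventually (\<lambda>i. \<not> P i) U\<close> have "eventually (\<lambda>_. False) U"
      by eventually_elim simp
    with assms show False
      by (simp add: ultrafilter_def trivial_limit_def[symmetric])
  qed
qed (use ultrafilterD[OF assms] in blast)

lemma ultrafilter_eventually_disj:
  assumes "ultrafilter U"
  shows "eventually (\<lambda>i. P i \<or> Q i) U \<longleftrightarrow> eventually P U \<or> eventually Q U"
proof -
  have "eventually (\<lambda>i. \<not> (P i \<or> Q i)) U
      \<longleftrightarrow> eventually (\<lambda>i. \<not> P i) U \<and> eventually (\<lambda>i. \<not> Q i) U"
    by (simp add: eventually_conj_iff)
  then show ?thesis
    unfolding ultrafilter_eventually_not[OF assms] by blast
qed

lemma ultrafilter_eventually_Bex_finite: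
  assumes "ultrafilter U" "finite A"
  shows "eventually (\<lambda>i. \<exists>a\<in>A. P a i) U \<longleftrightarrow> (\<exists>a\<in>A. eventually (P a) U)"
  using assms(2)
proof induction
  case empty
  show ?case
    using assms(1) by (simp add: ultrafilter_def trivial_limit_def[symmetric])
next
  case (insert a A)
  then show ?case
    by (simp add: ultrafilter_eventually_disj[OF assms(1)])
qed

lemma ultrafilter_tendsto_Lim:
  fixes f :: "'i \<Rightarrow> 'b::{complete_linorder, linorder_topology}"
  assumes "ultrafilter U"
  shows "(f \<longlongrightarrow> Lim U f) U"
proof -
  \<comment> \<open>The largest eventual lower bound. A value above it is not an eventual lower
    bound, and an ultrafilter turns this failure into an eventual strict upper bound.\<close>
  define l where "l = Sup {y. eventually (\<lambda>i. y \<le> f i) U}"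
  have "(f \<longlongrightarrow> l) U"
  proof (rule order_tendstoI)
    fix a assume "a < l"
    then obtain y where "a < y" "eventually (\<lambda>i. y \<le> f i) U"
      unfolding l_def less_Sup_iff by blast
    then show "eventually (\<lambda>i. a < f i) U"
      by (auto elim: eventually_mono)
  next
    fix a assume "l < a"
    have "\<not> eventually (\<lambda>i. a \<le> f i) U"
    proof
      assume "eventually (\<lambda>i. a \<le> f i) U"
      then have "a \<le> l"
        unfolding l_def by (intro Sup_upper) simp
      with \<open>l < a\<close> show False by simp
    qed
    then show "eventually (\<lambda>i. f i < a) U"
      using ultrafilter_eventually_not[OF assms, of "\<lambda>i. a \<le> f i"] by (simp add: not_le)
  qed
  moreover have "U \<noteq> bot"
    using assms by (simp add: ultrafilter_def)
  ultimately show ?thesis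
    by (simp add: tendsto_Lim)
qed

lemma nonprincipal_ultrafilter_le_sequentially:
  fixes U :: "nat filter"
  assumes "nonprincipal_ultrafilter U"
  shows "U \<le> sequentially"
proof -
  have U: "ultrafilter U" and np: "\<And>i. U \<noteq> principal {i}"
    using assms by (auto simp: nonprincipal_ultrafilter_def)
  have ne: "eventually (\<lambda>n. n \<noteq> i) U" for i
  proof (rule ccontr)
    assume "\<not> ?thesis"
    then have i: "eventually (\<lambda>n. n = i) U"
      using ultrafilterD[OF U, of "\<lambda>n. n = i"] by simp
    have "eventually P U \<longleftrightarrow> P i" for P
    proof
      assume "eventually P U"
      with i have "eventually (\<lambda>_. P i) U"
        by eventually_elim simp
      then show "P i"
        using U by (auto simp: ultrafilter_def eventually_const_iff)
    qed (use i in \<open>auto elim: eventually_mono\<close>)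
    then have "U = principal {i}"
      by (simp add: filter_eq_iff eventually_principal)
    with np show False by blast
  qed
  show ?thesis
  proof (rule filter_leI)
    fix P :: "nat \<Rightarrow> bool"
    assume "eventually P sequentially"
    then obtain N where N: "\<And>n. n \<ge> N \<Longrightarrow> P n"
      by (auto simp: eventually_sequentially)
    have "eventually (\<lambda>n. \<forall>i\<in>{..<N}. n \<noteq> i) U"
      by (intro eventually_ball_finite) (auto intro: ne)
    then show "eventually P U"
      by eventually_elim (use N in \<open>auto simp: not_less[symmetric]\<close>)
  qed
qed

text \<open>Finer filters are smaller, so Zorn's lemma is applied downwards, to the proper filters
  below \<open>F\<close>. A minimal one decides every \<open>P\<close>: restricting it to
  \<open>P\<close> yields either \<open>bot\<close> or the same filter.\<close>

lemma ex_ultrafilter_le: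
  assumes "F \<noteq> (bot :: 'i filter)"
  shows "\<exists>U\<le>F. ultrafilter U"
proof -
  define A where "A = {G. G \<noteq> bot \<and> G \<le> F}"
  have "\<exists>m\<in>A. \<forall>a\<in>A. m \<ge> a \<longrightarrow> a = m"
  proof (rule predicate_Zorn)
    show "partial_order_on A (relation_of (\<lambda>x y. y \<le> x) A)"
      by (rule partial_order_on_relation_ofI) auto
  next
    fix C assume C: "C \<in> Chains (relation_of (\<lambda>x y. y \<le> x) A)"
    then have CA: "C \<subseteq> A"
      by (auto simp: Chains_def relation_of_def)
    show "\<exists>u\<in>A. \<forall>a\<in>C. u \<le> a"
    proof (cases "C = {}")
      case True
      with assms show ?thesis by (auto simp: A_def)
    next
      case False
      have "\<exists>x\<in>C. x \<le> inf G H" if "G \<in> C" "H \<in> C" for G H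
        using C that unfolding Chains_def relation_of_def by fastforce
      then have "eventually P (Inf C) \<longleftrightarrow> (\<exists>b\<in>C. eventually P b)" for P
        by (rule eventually_Inf_base[OF False])
      \<comment> \<open>A chain is directed, so what holds eventually in \<open>Inf C\<close>
        already holds eventually in one member, and all members are proper.\<close>
      then have "Inf C \<noteq> bot"
        using CA by (auto simp: trivial_limit_def A_def)
      moreover have "Inf C \<le> F"
        using False CA by (auto simp: A_def intro: Inf_lower2)
      ultimately show ?thesis
        by (intro bexI[of _ "Inf C"]) (auto simp: A_def intro: Inf_lower)
    qed
  qed
  then obtain U where U: "U \<noteq> bot" "U \<le> F"
    and min: "\<And>G. G \<noteq> bot \<Longrightarrow> G \<le> F \<Longrightarrow> G \<le> U \<Longrightarrow> G = U"
    by (auto simp: A_def)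
  have "eventually P U \<or> eventually (\<lambda>i. \<not> P i) U" for P
  proof (cases "inf U (principal {i. P i}) = bot")
    case True
    then show ?thesis
      by (simp add: trivial_limit_def eventually_inf_principal)
  next
    case False
    then have "inf U (principal {i. P i}) = U"
      using U by (intro min) (auto intro: le_infI1)
    moreover have "eventually P (inf U (principal {i. P i}))"
      by (simp add: eventually_inf_principal)
    ultimately show ?thesis by simp
  qed
  with U show ?thesis
    by (auto simp: ultrafilter_def)
qed

text \<open>The trace of the cofinite filter on an infinite set is proper. An ultrafilter below it
  contains all cofinite sets, hence is not principal.\<close>

lemma ex_nonprincipal_ultrafilter:
  assumes "infinite (J :: nat set)"
  shows "\<exists>U. nonprincipal_ultrafilter U \<and> eventually (\<lambda>n. n \<in> J) U"
proof -
  have "inf sequentially (principal J) \<noteq> bot"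
  proof
    assume "inf sequentially (principal J) = bot"
    then have "eventually (\<lambda>n. n \<notin> J) sequentially"
      by (simp add: trivial_limit_def eventually_inf_principal)
    then obtain N where "\<forall>n\<ge>N. n \<notin> J"
      by (auto simp: eventually_sequentially)
    then have "J \<subseteq> {..<N}"
      by (auto simp: not_less[symmetric])
    with assms show False
      using finite_subset by blast
  qed
  then obtain U where U: "U \<le> inf sequentially (principal J)" "ultrafilter U"
    using ex_ultrafilter_le by blast
  have "eventually (\<lambda>n. n \<in> J) U"
    using U(1) by (rule filter_leD) (simp add: eventually_inf_principal)
  moreover have "U \<noteq> principal {i}" for i
  proof
    assume "U = principal {i}"
    moreover have "eventually (\<lambda>n. n > i) U"
      using U(1) filter_leD[OF _ eventually_gt_at_top[of i]] by simp
    ultimately show False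
      by (simp add: eventually_principal)
  qed
  ultimately show ?thesis
    using U(2) by (auto simp: nonprincipal_ultrafilter_def)
qed

text \<open>Choosing \<open>N n\<close> as the largest \<open>i \<le> n\<close> with \<open>P i n\<close>; this is what makes ultraproducts over
  \<open>\<nat>\<close> countably saturated.\<close>

lemma diagonal_choice:
  fixes F :: "nat filter" and P :: "nat \<Rightarrow> nat \<Rightarrow> bool"
  assumes "F \<le> sequentially" "\<And>i. eventually (P i) F"
  shows "\<exists>N. eventually (\<lambda>n. P (N n) n) F \<and> (\<forall>i. eventually (\<lambda>n. i \<le> N n) F)"
proof -
  define N where "N n = (GREATEST i. i \<le> n \<and> P i n)" for n
  have N: "i \<le> N n \<and> P (N n) n" if "i \<le> n" "P i n" for i n
    using GreatestI_nat[of "\<lambda>i. i \<le> n \<and> P i n" i n] Greatest_le_nat[of "\<lambda>i. i \<le> n \<and> P i n" i n] that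
    by (auto simp: N_def)
  have ev: "eventually (\<lambda>n. i \<le> N n \<and> P (N n) n) F" for i
    using assms(2)[of i] filter_leD[OF assms(1) eventually_ge_at_top[of i]]
    by eventually_elim (rule N)
  show ?thesis
  proof (intro exI conjI allI)
    show "eventually (\<lambda>n. P (N n) n) F"
      using ev[of 0] by eventually_elim simp
    show "eventually (\<lambda>n. i \<le> N n) F" for i
      using ev[of i] by eventually_elim simp
  qed
qed

subsection \<open>Graph distance\<close>

abbreviation adj :: "'a set set \<Rightarrow> ('a \<times> 'a) set" where
  "adj E \<equiv> {(u, v). {u, v} \<in> E}"

lemma gdist_le_iff: "gdist E x y \<le> enat k \<longleftrightarrow> (\<exists>j\<le>k. (x, y) \<in> adj E ^^ j)"
proof
  let ?K = "enat ` {j. (x, y) \<in> adj E ^^ j}"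
  assume le: "gdist E x y \<le> enat k"
  have "?K \<noteq> {}"
  proof
    assume "?K = {}"
    then have "gdist E x y = \<infinity>"
      by (simp only: gdist_def mem_Collect_eq) (simp add: top_enat_def)
    with le show False by simp
  qed
  then have "(LEAST e. e \<in> ?K) \<in> ?K"
    by (meson LeastI ex_in_conv)
  with \<open>?K \<noteq> {}\<close> have "Inf ?K \<in> ?K"
    by (simp only: Inf_enat_def if_False)
  then obtain j where "Inf ?K = enat j" "(x, y) \<in> adj E ^^ j"
    by auto
  then show "\<exists>j\<le>k. (x, y) \<in> adj E ^^ j"
    using le by (auto simp: gdist_def)
next
  assume "\<exists>j\<le>k. (x, y) \<in> adj E ^^ j"
  then show "gdist E x y \<le> enat k"
    unfolding gdist_def by (auto intro: INF_lower2)
qed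

lemma gdist_refl [simp]: "gdist E x x = 0"
  using gdist_le_iff[of E x x 0] by (simp add: zero_enat_def[symmetric])

lemma gdist_le_1: "{x, y} \<in> E \<Longrightarrow> gdist E x y \<le> enat 1"
  by (auto simp: gdist_le_iff intro: exI[of _ 1])

lemma sym_relpow: "sym R \<Longrightarrow> sym (R ^^ n)"
proof (induction n)
  case (Suc n)
  show ?case
  proof (rule symI)
    fix x y assume "(x, y) \<in> R ^^ Suc n"
    then obtain z where "(x, z) \<in> R ^^ n" "(z, y) \<in> R" by auto
    then have "(z, x) \<in> R ^^ n" "(y, z) \<in> R"
      using Suc by (auto dest: symD)
    then show "(y, x) \<in> R ^^ Suc n"
      by (rule relpow_Suc_I2[rotated])
  qed
qed (simp add: sym_Id)

lemma gdist_commute: "gdist E x y = gdist E y x"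
proof -
  have "sym (adj E ^^ j)" for j
    by (rule sym_relpow) (auto simp: sym_def insert_commute)
  then have "(x, y) \<in> adj E ^^ j \<longleftrightarrow> (y, x) \<in> adj E ^^ j" for j
    by (metis symD)
  then show ?thesis
    by (simp add: gdist_def)
qed

lemma gdist_triangle:
  assumes "gdist E x y \<le> enat k" "gdist E y z \<le> enat l"
  shows "gdist E x z \<le> enat (k + l)"
proof -
  obtain i j where "i \<le> k" "j \<le> l" "(x, y) \<in> adj E ^^ i" "(y, z) \<in> adj E ^^ j"
    using assms by (auto simp: gdist_le_iff)
  then show ?thesis
    unfolding gdist_le_iff by (intro exI[of _ "i + j"]) (auto simp: relpow_add)
qed

text \<open>Induction with the triangle inequality. \<open>R\<close> is arbitrary so that it can be
  an internal relation inside a ball, the steps of a competing graph, or the edges of another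
  graph.\<close>

lemma gdist_relpow:
  assumes "\<And>x y. (x, y) \<in> R \<Longrightarrow> gdist E x y \<le> enat k" "(x, y) \<in> R ^^ m"
  shows "gdist E x y \<le> enat (m * k)"
  using assms(2)
proof (induction m arbitrary: y)
  case (Suc m)
  then obtain z where z: "(x, z) \<in> R ^^ m" "(z, y) \<in> R" by auto
  then have "gdist E x y \<le> enat (m * k + k)"
    using Suc.IH assms(1) by (blast intro: gdist_triangle)
  then show ?case by (simp add: add.commute)
qed (simp add: zero_enat_def[symmetric])

lemma card_gdist_ball_le:
  assumes fin: "finite_graph V E" and deg: "\<And>x. x \<in> V \<Longrightarrow> card {y. {x, y} \<in> E} \<le> D"
  shows "finite {y. gdist E x y \<le> enat k} \<and> card {y. gdist E x y \<le> enat k} \<le> (\<Sum>j\<le>k. D ^ j)"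
proof -
  have nbr: "finite {y. {x, y} \<in> E} \<and> card {y. {x, y} \<in> E} \<le> D" for x
  proof (cases "x \<in> V")
    case True
    have "{y. {x, y} \<in> E} \<subseteq> V"
      using fin by (auto simp: finite_graph_def)
    then show ?thesis
      using deg[OF True] fin finite_subset by (auto simp: finite_graph_def)
  next
    \<comment> \<open>Points outside \<open>V\<close> have no neighbours and satisfy the bound too,
      so the ball estimate needs no assumption on the centre.\<close>
    case False
    then have "{y. {x, y} \<in> E} = {}"
      using fin by (auto simp: finite_graph_def)
    then show ?thesis by simp
  qed
  have sph: "finite {y. (x, y) \<in> adj E ^^ j} \<and> card {y. (x, y) \<in> adj E ^^ j} \<le> D ^ j" for j
  proof (induction j)
    case (Suc j)
    have eq: "{y. (x, y) \<in> adj E ^^ Suc j} = (\<Union>z\<in>{z. (x, z) \<in> adj E ^^ j}. {y. {z, y} \<in> E})"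
      by auto
    have "card (\<Union>z\<in>{z. (x, z) \<in> adj E ^^ j}. {y. {z, y} \<in> E})
        \<le> (\<Sum>z\<in>{z. (x, z) \<in> adj E ^^ j}. card {y. {z, y} \<in> E})"
      using Suc by (intro card_UN_le) auto
    also have "\<dots> \<le> (\<Sum>z\<in>{z. (x, z) \<in> adj E ^^ j}. D)"
      using nbr by (intro sum_mono) auto
    also have "\<dots> \<le> D ^ j * D"
      using Suc by simp
    finally show ?case
      unfolding eq using Suc nbr by (auto simp: mult.commute)
  qed simp
  have eq: "{y. gdist E x y \<le> enat k} = (\<Union>j\<le>k. {y. (x, y) \<in> adj E ^^ j})"
    by (auto simp: gdist_le_iff)
  have "card (\<Union>j\<le>k. {y. (x, y) \<in> adj E ^^ j}) \<le> (\<Sum>j\<le>k. card {y. (x, y) \<in> adj E ^^ j})"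
    by (intro card_UN_le) auto
  also have "\<dots> \<le> (\<Sum>j\<le>k. D ^ j)"
    using sph by (intro sum_mono) auto
  finally show ?thesis
    unfolding eq using sph by auto
qed

subsection \<open>Relation powers and generated equivalences\<close>

text \<open>Exponents are successors throughout: \<open>R ^^ 0\<close> is the identity of the whole
  type, which is not contained in \<open>W \<times> W\<close>.\<close>

lemma relpow_Suc_subset_square: "R \<subseteq> W \<times> W \<Longrightarrow> R ^^ Suc m \<subseteq> W \<times> W"
proof (induction m)
  case (Suc m)
  then have "R ^^ Suc m O R \<subseteq> W \<times> W"
    by (intro relcomp_subset_Sigma)
  then show ?case by simp
qed simp

lemma relpow_subset_relpow: "(R :: ('a \<times> 'a) set) \<subseteq> S \<Longrightarrow> R ^^ n \<subseteq> S ^^ n"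
  by (induction n) (simp_all add: relcomp_mono)

text \<open>Shorter walks are padded with loops at their endpoint.\<close>

lemma relpow_Suc_mono_refl:
  assumes "R \<subseteq> S" "R \<subseteq> X \<times> X" "Id_on X \<subseteq> S" "k \<le> l"
  shows "R ^^ Suc k \<subseteq> S ^^ Suc l"
  using assms(4)
proof (induction l rule: dec_induct)
  case base
  show ?case
    using assms(1) by (rule relpow_subset_relpow)
next
  case (step l)
  show ?case
  proof
    fix p assume p: "p \<in> R ^^ Suc k"
    then have "p \<in> X \<times> X"
      using relpow_Suc_subset_square[OF assms(2)] by blast
    then have "(snd p, snd p) \<in> S"
      using assms(3) by auto
    moreover have "p \<in> S ^^ Suc l"
      using p step.IH by blast
    ultimately show "p \<in> S ^^ Suc (Suc l)"
      by (cases p) (auto intro: relpow_Suc_I)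
  qed
qed

lemma equiv_UN_relpow:
  fixes R :: "nat \<Rightarrow> ('b \<times> 'b) set"
  assumes sub: "\<And>m. R m \<subseteq> X \<times> X" and refl: "Id_on X \<subseteq> R 0"
    and sym: "\<And>m. sym (R m)" and mono: "mono R"
  shows "equiv X (\<Union>m. R m ^^ Suc m)"
proof (rule equivI)
  show "(\<Union>m. R m ^^ Suc m) \<subseteq> X \<times> X"
    using relpow_Suc_subset_square[OF sub] by blast
  show "refl_on X (\<Union>m. R m ^^ Suc m)"
  proof (rule refl_onI)
    fix x assume "x \<in> X"
    then have "(x, x) \<in> R 0 ^^ Suc 0"
      using refl by auto
    then show "(x, x) \<in> (\<Union>m. R m ^^ Suc m)" by blast
  qed
  show "sym (\<Union>m. R m ^^ Suc m)"
    by (intro sym_UNION ballI sym_relpow sym)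
  show "trans (\<Union>m. R m ^^ Suc m)"
  proof (rule transI)
    fix x y z assume "(x, y) \<in> (\<Union>m. R m ^^ Suc m)" "(y, z) \<in> (\<Union>m. R m ^^ Suc m)"
    then obtain k l where kl: "(x, y) \<in> R k ^^ Suc k" "(y, z) \<in> R l ^^ Suc l"
      by blast
    \<comment> \<open>\<open>Suc k + Suc l = Suc m\<close>, and \<open>m\<close> exceeds both
      indices, so the concatenated walk belongs to a single term of the union.\<close>
    define m where "m = k + l + 1"
    have "R k ^^ Suc k \<subseteq> R m ^^ Suc k" "R l ^^ Suc l \<subseteq> R m ^^ Suc l"
      by (intro relpow_subset_relpow monoD[OF mono]; simp add: m_def)+
    with kl have "(x, z) \<in> R m ^^ Suc k O R m ^^ Suc l"
      by blast
    also have "\<dots> = R m ^^ Suc m"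
      unfolding relpow_add[symmetric] by (simp add: m_def)
    finally show "(x, z) \<in> (\<Union>m. R m ^^ Suc m)" by blast
  qed
qed

lemma trans_relpow_Suc_subset:
  assumes "trans R"
  shows "R ^^ Suc m \<subseteq> R"
proof (induction m)
  case (Suc m)
  have "R ^^ Suc m O R \<subseteq> R O R"
    using Suc.IH by (rule relcomp_mono) simp
  also have "\<dots> \<subseteq> R"
    using assms by (simp add: trans_O_subset)
  finally show ?case by simp
qed simp

lemma generated_equiv_subset:
  assumes "equiv X R" "\<And>i. \<Phi> i \<subseteq> R"
  shows "generated_equiv X \<Phi> \<subseteq> R"
  using assms by (auto simp: generated_equiv_def)

lemma half_powers_sum_le: "(\<Sum>j\<le>i. (1 / 2 :: real) ^ Suc j) \<le> 1"
proof -
  have "(\<Sum>j\<le>i. (1 / 2 :: real) ^ Suc j) = 1 - (1 / 2) ^ Suc i"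
    by (induction i) auto
  then show ?thesis by simp
qed

subsection \<open>Orientations and colourings\<close>

text \<open>One ordered pair per edge: a graphing need not contain the inverses of its bisections,
  and the combinatorial cost counts each edge once.\<close>

lemma finite_graph_ex_orientation:
  assumes "finite_graph V F"
  shows "\<exists>Q\<subseteq>V \<times> V. inj_on (\<lambda>(x, y). {x, y}) Q \<and> F = (\<lambda>(x, y). {x, y}) ` Q"
proof -
  have "F \<subseteq> (\<lambda>(x, y). {x, y}) ` (V \<times> V)"
  proof
    fix e assume "e \<in> F"
    then have "e \<subseteq> V" "card e = 2"
      using assms by (auto simp: finite_graph_def)
    then obtain x y where "e = {x, y}" "x \<in> V" "y \<in> V"
      by (auto simp: card_2_iff)
    then show "e \<in> (\<lambda>(x, y). {x, y}) ` (V \<times> V)"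
      by (auto intro!: image_eqI[of _ _ "(x, y)"])
  qed
  then show ?thesis
    by (simp add: subset_image_inj)
qed

text \<open>The colour of \<open>(x, y)\<close> encodes the rank of \<open>y\<close> among the successors of \<open>x\<close> and the rank of
  \<open>x\<close> among the predecessors of \<open>y\<close>.\<close>

lemma ex_coloring_partial_injections:
  fixes R :: "('a \<times> 'b) set"
  assumes succ: "\<And>x. finite {y. (x, y) \<in> R} \<and> card {y. (x, y) \<in> R} \<le> N"
    and pred: "\<And>y. finite {x. (x, y) \<in> R} \<and> card {x. (x, y) \<in> R} \<le> N"
  shows "\<exists>g. (\<forall>p\<in>R. g p < N * N)
    \<and> (\<forall>i. inj_on fst {p \<in> R. g p = i} \<and> inj_on snd {p \<in> R. g p = i})"
proof -
  have "\<forall>x. \<exists>f. f ` {y. (x, y) \<in> R} \<subseteq> {..<N} \<and> inj_on f {y. (x, y) \<in> R}"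
    using succ by (intro allI card_le_inj) auto
  then obtain f where f: "\<And>x. f x ` {y. (x, y) \<in> R} \<subseteq> {..<N}" "\<And>x. inj_on (f x) {y. (x, y) \<in> R}"
    by metis
  have "\<forall>y. \<exists>h. h ` {x. (x, y) \<in> R} \<subseteq> {..<N} \<and> inj_on h {x. (x, y) \<in> R}"
    using pred by (intro allI card_le_inj) auto
  then obtain h where h: "\<And>y. h y ` {x. (x, y) \<in> R} \<subseteq> {..<N}" "\<And>y. inj_on (h y) {x. (x, y) \<in> R}"
    by metis
  \<comment> \<open>Two digits in base \<open>N\<close>: quotient and remainder recover both ranks,
    whence \<open>N * N\<close> colours.\<close>
  define g where "g = (\<lambda>(x, y). f x y * N + h y x)"
  have less: "f x y < N" "h y x < N" if "(x, y) \<in> R" for x y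
    using that f(1)[of x] h(1)[of y] by auto
  have "g p < N * N" if "p \<in> R" for p
  proof -
    obtain x y where p: "p = (x, y)" by fastforce
    then have "Suc (f x y) * N \<le> N * N" "h y x < N"
      using less[of x y] that by (simp_all only: Suc_le_eq mult_le_mono1)
    then show ?thesis
      by (simp add: g_def p)
  qed
  moreover have g: "g (x, y) div N = f x y \<and> g (x, y) mod N = h y x" if "(x, y) \<in> R" for x y
    using less[OF that] by (simp add: g_def)
  have "inj_on fst {p \<in> R. g p = i}" for i
  proof (rule inj_onI; clarsimp)
    fix x y y' assume "(x, y) \<in> R" "(x, y') \<in> R" "g (x, y') = g (x, y)"
    then show "y = y'"
      using g[of x y] g[of x y'] inj_onD[OF f(2)[of x], of y y'] by simp
  qed
  moreover have "inj_on snd {p \<in> R. g p = i}" for i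
  proof (rule inj_onI; clarsimp)
    fix x x' y assume "(x, y) \<in> R" "(x', y) \<in> R" "g (x', y) = g (x, y)"
    then show "x = x'"
      using g[of x y] g[of x' y] inj_onD[OF h(2)[of y], of x x'] by simp
  qed
  ultimately show ?thesis by blast
qed

subsection \<open>Internal relations\<close>

locale ultra_graph_sequence =
  fixes U :: "nat filter" and V :: "nat \<Rightarrow> 'a set" and E :: "nat \<Rightarrow> 'a set set"
  assumes nonprincipal: "nonprincipal_ultrafilter U"
    and graph: "\<And>n. finite_graph (V n) (E n)"
    and bounded: "bounded_degree V E"
begin

abbreviation "units \<equiv> ultraproduct U V"
abbreviation "cls \<equiv> ultra_class U V"
abbreviation "internal \<equiv> internal_rel U V"
abbreviation "groupoid \<equiv> ultra_groupoid U V E"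
abbreviation "uniform \<equiv> uniform_subrels V E"

text \<open>The restriction to \<open>V n\<close> matters: \<open>gdist\<close> vanishes on the
  diagonal of the whole type.\<close>

definition gball :: "nat \<Rightarrow> nat \<Rightarrow> ('a \<times> 'a) set" where
  "gball k n = {(x, y) \<in> V n \<times> V n. gdist (E n) x y \<le> enat k}"

abbreviation density :: "(nat \<Rightarrow> ('a \<times> 'a) set) \<Rightarrow> nat \<Rightarrow> ennreal" where
  "density S n \<equiv> ennreal (real (card (S n)) / real (card (V n)))"

definition mass :: "(nat \<Rightarrow> ('a \<times> 'a) set) \<Rightarrow> ennreal" where
  "mass S = Lim U (density S)"

text \<open>The measure before completion. Its sigma-algebra is generated by the internal sets, so
  regularity can be proved by induction over it.\<close>

definition loeb :: "((nat \<Rightarrow> 'a) set \<times> (nat \<Rightarrow> 'a) set) measure" where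
  "loeb = extend_measure groupoid uniform internal mass"

lemma ultra: "ultrafilter U"
  using nonprincipal by (simp add: nonprincipal_ultrafilter_def)

lemma U_neq_bot [simp]: "U \<noteq> bot"
  using ultra by (simp add: ultrafilter_def)

lemma le_sequentially: "U \<le> sequentially"
  using nonprincipal by (rule nonprincipal_ultrafilter_le_sequentially)

lemma finite_V [simp]: "finite (V n)" and V_nonempty [simp]: "V n \<noteq> {}"
  using graph[of n] by (auto simp: finite_graph_def)

lemma edge_in_V: "{x, y} \<in> E n \<Longrightarrow> x \<in> V n \<and> y \<in> V n \<and> x \<noteq> y"
proof -
  assume "{x, y} \<in> E n"
  then have "{x, y} \<subseteq> V n" "card {x, y} = 2"
    using graph[of n] by (auto simp: finite_graph_def)
  then show ?thesis by auto
qed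

lemma not_eventually_U: "eventually (\<lambda>i. \<not> P i) U \<longleftrightarrow> \<not> eventually P U"
  by (rule ultrafilter_eventually_not[OF ultra])

lemma cls_eq_iff:
  assumes "x \<in> Pi UNIV V" "y \<in> Pi UNIV V"
  shows "cls x = cls y \<longleftrightarrow> eventually (\<lambda>n. x n = y n) U"
proof -
  have "equiv (Pi UNIV V) (ultra_rel U V)"
  proof (rule equivI)
    show "trans (ultra_rel U V)"
    proof (rule transI)
      fix x y z assume "(x, y) \<in> ultra_rel U V" "(y, z) \<in> ultra_rel U V"
      then have xz: "x \<in> Pi UNIV V" "z \<in> Pi UNIV V"
        and ev: "eventually (\<lambda>n. x n = y n) U" "eventually (\<lambda>n. y n = z n) U"
        by (simp_all add: ultra_rel_def)
      have "eventually (\<lambda>n. x n = z n) U"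
        using ev by eventually_elim simp
      with xz show "(x, z) \<in> ultra_rel U V"
        by (simp add: ultra_rel_def)
    qed
    show "sym (ultra_rel U V)"
      by (simp add: sym_def ultra_rel_def eq_commute)
  qed (auto simp: ultra_rel_def refl_on_def)
  then have "cls x = cls y \<longleftrightarrow> (x, y) \<in> ultra_rel U V"
    unfolding ultra_class_def using assms by (rule eq_equiv_class_iff)
  also have "\<dots> \<longleftrightarrow> eventually (\<lambda>n. x n = y n) U"
    using assms by (simp add: ultra_rel_def)
  finally show ?thesis .
qed

lemma units_eq: "units = cls ` Pi UNIV V"
  by (auto simp: ultraproduct_def quotient_def ultra_class_def)

text \<open>The definition asks for some pair of representatives; changing representatives affects
  only a negligible set of indices. This is the atomic case of Los's theorem.\<close>

lemma internal_iff:
  assumes "x \<in> Pi UNIV V" "y \<in> Pi UNIV V"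
  shows "(cls x, cls y) \<in> internal S \<longleftrightarrow> eventually (\<lambda>n. (x n, y n) \<in> S n) U"
proof
  assume "(cls x, cls y) \<in> internal S"
  then obtain x' y' where "x' \<in> Pi UNIV V" "y' \<in> Pi UNIV V" "cls x = cls x'" "cls y = cls y'"
    and S: "eventually (\<lambda>n. (x' n, y' n) \<in> S n) U"
    by (auto simp: internal_rel_def)
  then have "eventually (\<lambda>n. x n = x' n) U" "eventually (\<lambda>n. y n = y' n) U"
    using assms by (simp_all add: cls_eq_iff)
  with S show "eventually (\<lambda>n. (x n, y n) \<in> S n) U"
    by eventually_elim simp
qed (use assms in \<open>auto simp: internal_rel_def\<close>)

lemma internal_subset_units: "internal S \<subseteq> units \<times> units"
  by (auto simp: internal_rel_def units_eq)

lemma units_rel_subsetI: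
  assumes "A \<subseteq> units \<times> units"
    and "\<And>x y. x \<in> Pi UNIV V \<Longrightarrow> y \<in> Pi UNIV V \<Longrightarrow> (cls x, cls y) \<in> A \<Longrightarrow> (cls x, cls y) \<in> B"
  shows "A \<subseteq> B"
proof
  fix p assume "p \<in> A"
  moreover from this obtain x y where "x \<in> Pi UNIV V" "y \<in> Pi UNIV V" "p = (cls x, cls y)"
    using assms(1) by (auto simp: units_eq)
  ultimately show "p \<in> B"
    using assms(2) by blast
qed

lemma units_rel_eqI:
  assumes "A \<subseteq> units \<times> units" "B \<subseteq> units \<times> units"
    and "\<And>x y. x \<in> Pi UNIV V \<Longrightarrow> y \<in> Pi UNIV V \<Longrightarrow> (cls x, cls y) \<in> A \<longleftrightarrow> (cls x, cls y) \<in> B"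
  shows "A = B"
proof (rule subset_antisym)
  show "A \<subseteq> B"
    by (rule units_rel_subsetI[OF assms(1)]) (simp add: assms(3))
  show "B \<subseteq> A"
    by (rule units_rel_subsetI[OF assms(2)]) (simp add: assms(3))
qed

lemma internal_Un: "internal (\<lambda>n. S n \<union> T n) = internal S \<union> internal T"
  by (rule units_rel_eqI)
     (use internal_subset_units in \<open>auto simp: internal_iff ultrafilter_eventually_disj[OF ultra]\<close>)

lemma internal_Int: "internal (\<lambda>n. S n \<inter> T n) = internal S \<inter> internal T"
  by (rule units_rel_eqI)
     (use internal_subset_units in \<open>auto simp: internal_iff eventually_conj_iff\<close>)

lemma internal_Diff: "internal (\<lambda>n. S n - T n) = internal S - internal T"
  by (rule units_rel_eqI)
     (use internal_subset_units in \<open>auto simp: internal_iff eventually_conj_iff not_eventually_U\<close>)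

lemma internal_converse: "internal (\<lambda>n. (S n)\<inverse>) = (internal S)\<inverse>"
  by (rule units_rel_eqI) (use internal_subset_units in \<open>auto simp: internal_iff\<close>)

lemma internal_UN:
  assumes "finite A"
  shows "internal (\<lambda>n. \<Union>a\<in>A. S a n) = (\<Union>a\<in>A. internal (S a))"
  by (rule units_rel_eqI)
     (use internal_subset_units assms in
       \<open>auto simp: internal_iff ultrafilter_eventually_Bex_finite[OF ultra]\<close>)

lemma internal_empty: "internal (\<lambda>n. {}) = {}"
  by (simp add: internal_rel_def)

lemma internal_Id_on: "internal (\<lambda>n. Id_on (V n)) = Id_on units"
proof (rule units_rel_eqI)
  fix x y assume xy: "x \<in> Pi UNIV V" "y \<in> Pi UNIV V"
  then have "(x n, y n) \<in> Id_on (V n) \<longleftrightarrow> x n = y n" for n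
    by auto
  then show "(cls x, cls y) \<in> internal (\<lambda>n. Id_on (V n)) \<longleftrightarrow> (cls x, cls y) \<in> Id_on units"
    using xy by (auto simp: internal_iff cls_eq_iff Id_on_iff units_eq)
qed (use internal_subset_units in auto)

lemma internal_relcomp:
  assumes "\<And>n. S n \<subseteq> V n \<times> V n"
  shows "internal (\<lambda>n. S n O T n) = internal S O internal T"
proof (rule units_rel_eqI)
  fix x y assume xy: "x \<in> Pi UNIV V" "y \<in> Pi UNIV V"
  show "(cls x, cls y) \<in> internal (\<lambda>n. S n O T n) \<longleftrightarrow> (cls x, cls y) \<in> internal S O internal T"
  proof
    assume "(cls x, cls y) \<in> internal (\<lambda>n. S n O T n)"
    then have ev: "eventually (\<lambda>n. (x n, y n) \<in> S n O T n) U"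
      using xy by (simp add: internal_iff)
    \<comment> \<open>Where the pair is not in the composition, any vertex of the nonempty
      \<open>V n\<close> serves as a default, so that the sequence of midpoints still defines a
      unit.\<close>
    have "\<exists>z. z \<in> V n \<and> ((x n, y n) \<in> S n O T n \<longrightarrow> (x n, z) \<in> S n \<and> (z, y n) \<in> T n)" for n
    proof (cases "(x n, y n) \<in> S n O T n")
      case True
      with assms[of n] show ?thesis by blast
    qed (use V_nonempty[of n] in blast)
    then obtain z where z: "\<And>n. z n \<in> V n"
        "\<And>n. (x n, y n) \<in> S n O T n \<Longrightarrow> (x n, z n) \<in> S n \<and> (z n, y n) \<in> T n"
      by metis
    have "eventually (\<lambda>n. (x n, z n) \<in> S n \<and> (z n, y n) \<in> T n) U"
      using ev by eventually_elim (rule z(2))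
    then have "(cls x, cls z) \<in> internal S" "(cls z, cls y) \<in> internal T"
      using xy z(1) by (auto simp: internal_iff eventually_conj_iff)
    then show "(cls x, cls y) \<in> internal S O internal T"
      by auto
  next
    assume "(cls x, cls y) \<in> internal S O internal T"
    then obtain z' where z': "(cls x, z') \<in> internal S" "(z', cls y) \<in> internal T"
      by auto
    then have "z' \<in> units"
      using internal_subset_units[of S] by blast
    then obtain z where z: "z \<in> Pi UNIV V" "z' = cls z"
      by (auto simp: units_eq)
    have "eventually (\<lambda>n. (x n, z n) \<in> S n) U" "eventually (\<lambda>n. (z n, y n) \<in> T n) U"
      using z z' xy by (auto simp: internal_iff)
    then have "eventually (\<lambda>n. (x n, y n) \<in> S n O T n) U"
      by eventually_elim auto
    then show "(cls x, cls y) \<in> internal (\<lambda>n. S n O T n)"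
      using xy by (simp add: internal_iff)
  qed
next
  show "internal S O internal T \<subseteq> units \<times> units"
    by (rule relcomp_subset_Sigma[OF internal_subset_units internal_subset_units])
qed (rule internal_subset_units)

lemma internal_relpow:
  assumes "\<And>n. S n \<subseteq> V n \<times> V n"
  shows "internal (\<lambda>n. S n ^^ Suc m) = internal S ^^ Suc m"
proof (induction m)
  case (Suc m)
  have "internal (\<lambda>n. (S n ^^ Suc m) O S n) = internal (\<lambda>n. S n ^^ Suc m) O internal S"
    by (rule internal_relcomp[OF relpow_Suc_subset_square[OF assms]])
  then show ?case
    using Suc.IH by simp
qed simp

text \<open>The bridge back to the finite graphs. If inclusion failed at almost all
  \<open>n\<close>, the counterexamples chosen there would form a point of the difference; they lie
  in \<open>V n \<times> V n\<close> by the hypothesis on \<open>S\<close>.\<close>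

lemma internal_subset_iff:
  assumes "\<And>n. S n \<subseteq> V n \<times> V n"
  shows "internal S \<subseteq> internal T \<longleftrightarrow> eventually (\<lambda>n. S n \<subseteq> T n) U"
proof
  assume sub: "internal S \<subseteq> internal T"
  show "eventually (\<lambda>n. S n \<subseteq> T n) U"
  proof (rule ccontr)
    assume "\<not> ?thesis"
    then have ev: "eventually (\<lambda>n. \<not> S n \<subseteq> T n) U"
      by (simp add: not_eventually_U)
    have "\<exists>p. p \<in> V n \<times> V n \<and> (\<not> S n \<subseteq> T n \<longrightarrow> p \<in> S n - T n)" for n
    proof (cases "S n \<subseteq> T n")
      case False
      with assms[of n] show ?thesis by blast
    qed (use V_nonempty[of n] in blast)
    then obtain p where p: "\<And>n. p n \<in> V n \<times> V n" "\<And>n. \<not> S n \<subseteq> T n \<Longrightarrow> p n \<in> S n - T n"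
      by metis
    define x y where "x = fst \<circ> p" and "y = snd \<circ> p"
    have xy: "x \<in> Pi UNIV V" "y \<in> Pi UNIV V"
      using p(1) by (auto simp: x_def y_def mem_Times_iff)
    have "eventually (\<lambda>n. (x n, y n) \<in> S n - T n) U"
      using ev by eventually_elim (use p(2) in \<open>simp add: x_def y_def\<close>)
    then have "(cls x, cls y) \<in> internal S - internal T"
      using xy by (simp add: internal_iff flip: internal_Diff)
    with sub show False by blast
  qed
next
  assume ev: "eventually (\<lambda>n. S n \<subseteq> T n) U"
  show "internal S \<subseteq> internal T"
  proof (rule units_rel_subsetI[OF internal_subset_units])
    fix x y assume xy: "x \<in> Pi UNIV V" "y \<in> Pi UNIV V" and "(cls x, cls y) \<in> internal S"
    then have "eventually (\<lambda>n. (x n, y n) \<in> S n) U"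
      by (simp add: internal_iff)
    with ev have "eventually (\<lambda>n. (x n, y n) \<in> T n) U"
      by eventually_elim auto
    then show "(cls x, cls y) \<in> internal T"
      using xy by (simp add: internal_iff)
  qed
qed

lemma internal_mono: "(\<And>n. S n \<subseteq> T n) \<Longrightarrow> internal S \<subseteq> internal T"
proof (rule units_rel_subsetI[OF internal_subset_units])
  fix x y
  assume sub: "\<And>n. S n \<subseteq> T n" and xy: "x \<in> Pi UNIV V" "y \<in> Pi UNIV V"
    and "(cls x, cls y) \<in> internal S"
  then have "eventually (\<lambda>n. (x n, y n) \<in> S n) U"
    by (simp add: internal_iff)
  then have "eventually (\<lambda>n. (x n, y n) \<in> T n) U"
    by eventually_elim (use sub in auto)
  then show "(cls x, cls y) \<in> internal T"
    using xy by (simp add: internal_iff)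
qed

section \<open>Relations of uniformly bounded length\<close>

lemma uniform_iff: "S \<in> uniform \<longleftrightarrow> (\<exists>k. \<forall>n. S n \<subseteq> gball k n)"
proof
  assume "S \<in> uniform"
  then have sub: "\<And>n. S n \<subseteq> V n \<times> V n"
    and "(SUP n. SUP (x, y)\<in>S n. gdist (E n) x y) < \<infinity>"
    by (auto simp: uniform_subrels_def)
  \<comment> \<open>In \<open>enat\<close> a supremum below infinity is a number, so one
    \<open>k\<close> bounds the distances at all \<open>n\<close>.\<close>
  then obtain k where k: "(SUP n. SUP (x, y)\<in>S n. gdist (E n) x y) = enat k"
    by (meson less_infinityE)
  have "gdist (E n) x y \<le> enat k" if "(x, y) \<in> S n" for n x y
  proof -
    have "gdist (E n) x y \<le> (SUP (x, y)\<in>S n. gdist (E n) x y)"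
      using that by (rule SUP_upper2) simp
    also have "\<dots> \<le> enat k"
      unfolding k[symmetric] by (rule SUP_upper) simp
    finally show ?thesis .
  qed
  with sub show "\<exists>k. \<forall>n. S n \<subseteq> gball k n"
    by (fastforce simp: gball_def)
next
  assume "\<exists>k. \<forall>n. S n \<subseteq> gball k n"
  then obtain k where k: "\<And>n. S n \<subseteq> gball k n" by auto
  then have "(SUP n. SUP (x, y)\<in>S n. gdist (E n) x y) \<le> enat k"
    by (intro SUP_least) (fastforce simp: gball_def)
  also have "\<dots> < \<infinity>" by simp
  finally show "S \<in> uniform"
    using k by (auto simp: uniform_subrels_def gball_def)
qed

lemma uniform_subset: "S \<in> uniform \<Longrightarrow> S n \<subseteq> V n \<times> V n"
  by (auto simp: uniform_subrels_def)

lemma uniform_finite: "S \<in> uniform \<Longrightarrow> finite (S n)"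
  by (rule finite_subset[OF uniform_subset]) (simp_all add: finite_cartesian_product)

lemma uniform_mono: "T \<in> uniform \<Longrightarrow> (\<And>n. S n \<subseteq> T n) \<Longrightarrow> S \<in> uniform"
  unfolding uniform_iff by (meson subset_trans)

lemma uniform_Diff: "S \<in> uniform \<Longrightarrow> (\<lambda>n. S n - T n) \<in> uniform"
  by (erule uniform_mono) auto

lemma gball_mono: "k \<le> l \<Longrightarrow> gball k n \<subseteq> gball l n"
  by (auto simp: gball_def elim: order_trans)

lemma uniform_gball: "gball k \<in> uniform"
  by (auto simp: uniform_iff)

lemma uniform_UN:
  assumes "finite A" "\<And>a. a \<in> A \<Longrightarrow> S a \<in> uniform"
  shows "(\<lambda>n. \<Union>a\<in>A. S a n) \<in> uniform"
proof -
  have "\<forall>a\<in>A. \<exists>k. \<forall>n. S a n \<subseteq> gball k n"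
    using assms(2) by (auto simp: uniform_iff)
  then obtain k where k: "\<forall>a\<in>A. \<forall>n. S a n \<subseteq> gball (k a) n"
    by metis
  have "S a n \<subseteq> gball (Max (k ` A)) n" if "a \<in> A" for a n
  proof -
    have "k a \<le> Max (k ` A)"
      using that assms(1) by simp
    then show ?thesis
      using k gball_mono that by blast
  qed
  then show ?thesis
    unfolding uniform_iff by (intro exI[of _ "Max (k ` A)"]) auto
qed

lemma uniform_Un:
  assumes "S \<in> uniform" "T \<in> uniform"
  shows "(\<lambda>n. S n \<union> T n) \<in> uniform"
  using uniform_UN[of UNIV "\<lambda>b. if b then S else T"] assms by (simp add: UNIV_bool Un_commute)

lemma uniform_converse: "S \<in> uniform \<Longrightarrow> (\<lambda>n. (S n)\<inverse>) \<in> uniform"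
proof -
  have "(gball k n)\<inverse> = gball k n" for k n
    by (auto simp: gball_def gdist_commute)
  then show "S \<in> uniform \<Longrightarrow> ?thesis"
    unfolding uniform_iff by (metis converse_mono)
qed

lemma uniform_Id_on: "(\<lambda>n. Id_on (V n)) \<in> uniform"
  unfolding uniform_iff by (intro exI[of _ 0]) (auto simp: gball_def)

lemma uniform_relpow:
  assumes "S \<in> uniform"
  shows "(\<lambda>n. S n ^^ Suc m) \<in> uniform"
proof -
  obtain k where k: "\<And>n. S n \<subseteq> gball k n"
    using assms by (auto simp: uniform_iff)
  have "S n ^^ Suc m \<subseteq> gball (Suc m * k) n" for n
  proof
    fix p assume p: "p \<in> S n ^^ Suc m"
    then have "p \<in> V n \<times> V n"
      using relpow_Suc_subset_square[OF uniform_subset[OF assms]] by blast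
    moreover have "gdist (E n) (fst p) (snd p) \<le> enat (Suc m * k)"
      using k[of n] p by (intro gdist_relpow[of "S n"]) (auto simp: gball_def)
    ultimately show "p \<in> gball (Suc m * k) n"
      by (auto simp: gball_def)
  qed
  then show ?thesis
    by (auto simp: uniform_iff)
qed

lemma Lim_finite_iff:
  fixes f :: "nat \<Rightarrow> enat"
  shows "Lim U f < \<infinity> \<longleftrightarrow> (\<exists>k. eventually (\<lambda>n. f n \<le> enat k) U)"
proof
  assume "Lim U f < \<infinity>"
  then obtain k where "Lim U f = enat k"
    by (meson less_infinityE)
  \<comment> \<open>Convergence in the order topology yields strict bounds only; hence
    \<open>Suc k\<close>.\<close>
  then have "eventually (\<lambda>n. f n < enat (Suc k)) U"
    by (intro order_tendstoD(2)[OF ultrafilter_tendsto_Lim[OF ultra]]) simp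
  then show "\<exists>k. eventually (\<lambda>n. f n \<le> enat k) U"
    by (intro exI[of _ "Suc k"]) (rule eventually_mono, assumption, rule less_imp_le)
next
  assume "\<exists>k. eventually (\<lambda>n. f n \<le> enat k) U"
  then obtain k where "eventually (\<lambda>n. f n \<le> enat k) U" ..
  then have "Lim U f \<le> enat k"
    by (rule tendsto_upperbound[OF ultrafilter_tendsto_Lim[OF ultra] _ U_neq_bot])
  then show "Lim U f < \<infinity>"
    by (rule le_less_trans) simp
qed

text \<open>A finite limit of distances amounts to a bound at almost all \<open>n\<close>. This
  exhaustion by sets of finite mass allows measure arguments to be made ball by ball.\<close>

lemma groupoid_eq: "groupoid = (\<Union>k. internal (gball k))"
proof -
  have ball: "(x n, y n) \<in> gball k n \<longleftrightarrow> gdist (E n) (x n) (y n) \<le> enat k"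
    if "x \<in> Pi UNIV V" "y \<in> Pi UNIV V" for x y n k
    using that by (auto simp: gball_def)
  show ?thesis
  proof (intro set_eqI iffI)
    fix p assume "p \<in> groupoid"
    then obtain x y where xy: "p = (cls x, cls y)" "x \<in> Pi UNIV V" "y \<in> Pi UNIV V"
      and "Lim U (\<lambda>n. gdist (E n) (x n) (y n)) < \<infinity>"
      unfolding ultra_groupoid_def by blast
    then obtain k where "eventually (\<lambda>n. gdist (E n) (x n) (y n) \<le> enat k) U"
      unfolding Lim_finite_iff by blast
    then have "p \<in> internal (gball k)"
      using xy by (simp add: internal_iff ball)
    then show "p \<in> (\<Union>k. internal (gball k))" by blast
  next
    fix p assume "p \<in> (\<Union>k. internal (gball k))"
    then obtain k x y where xy: "p = (cls x, cls y)" "x \<in> Pi UNIV V" "y \<in> Pi UNIV V"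
      and "eventually (\<lambda>n. (x n, y n) \<in> gball k n) U"
      unfolding internal_rel_def by blast
    then have "Lim U (\<lambda>n. gdist (E n) (x n) (y n)) < \<infinity>"
      unfolding Lim_finite_iff by (auto simp: ball)
    with xy show "p \<in> groupoid"
      unfolding ultra_groupoid_def by blast
  qed
qed

lemma internal_subset_groupoid: "S \<in> uniform \<Longrightarrow> internal S \<subseteq> groupoid"
  unfolding uniform_iff groupoid_eq using internal_mono by blast

lemma groupoid_subset_units: "groupoid \<subseteq> units \<times> units"
  unfolding groupoid_eq using internal_subset_units by blast

subsection \<open>The Loeb measure\<close>

lemma mass_tendsto: "(density S \<longlongrightarrow> mass S) U"
  unfolding mass_def by (rule ultrafilter_tendsto_Lim[OF ultra])

lemma mass_le: "eventually (\<lambda>n. density S n \<le> c) U \<Longrightarrow> mass S \<le> c"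
  by (rule tendsto_upperbound[OF mass_tendsto _ U_neq_bot])

lemma mass_less: "mass S < c \<Longrightarrow> eventually (\<lambda>n. density S n < c) U"
  by (rule order_tendstoD(2)[OF mass_tendsto])

lemma density_mono: "S n \<subseteq> T n \<Longrightarrow> finite (T n) \<Longrightarrow> density S n \<le> density T n"
  by (intro ennreal_leI divide_right_mono) (auto intro: card_mono)

lemma mass_mono:
  assumes "T \<in> uniform" "eventually (\<lambda>n. S n \<subseteq> T n) U"
  shows "mass S \<le> mass T"
proof -
  have "eventually (\<lambda>n. density S n \<le> density T n) U"
    using assms(2) by eventually_elim (rule density_mono[OF _ uniform_finite[OF assms(1)]])
  then show ?thesis
    by (rule tendsto_le[OF U_neq_bot mass_tendsto mass_tendsto])
qed

text \<open>Well-definedness of the premeasure: equal internal sets have representing sequences that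
  agree at almost all \<open>n\<close>.\<close>

lemma mass_cong:
  assumes "S \<in> uniform" "T \<in> uniform" "internal S = internal T"
  shows "mass S = mass T"
proof (rule antisym)
  show "mass S \<le> mass T"
    using assms internal_subset_iff[of S T] by (intro mass_mono) (simp_all add: uniform_subset)
  show "mass T \<le> mass S"
    using assms internal_subset_iff[of T S] by (intro mass_mono) (simp_all add: uniform_subset)
qed

lemma mass_empty: "mass (\<lambda>n. {}) = 0"
  unfolding mass_def by (simp add: tendsto_Lim)

lemma mass_Un:
  assumes "S \<in> uniform" "T \<in> uniform" "eventually (\<lambda>n. S n \<inter> T n = {}) U"
  shows "mass (\<lambda>n. S n \<union> T n) = mass S + mass T"
proof (rule tendsto_unique[OF U_neq_bot mass_tendsto])
  have "eventually (\<lambda>n. density S n + density T n = density (\<lambda>n. S n \<union> T n) n) U"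
    using assms(3)
  proof eventually_elim
    case (elim n)
    then have "card (S n \<union> T n) = card (S n) + card (T n)"
      using assms uniform_finite by (intro card_Un_disjoint) auto
    then show ?case
      by (simp add: add_divide_distrib flip: ennreal_plus)
  qed
  then show "(density (\<lambda>n. S n \<union> T n) \<longlongrightarrow> mass S + mass T) U"
    by (rule Lim_transform_eventually[OF tendsto_add[OF mass_tendsto mass_tendsto]])
qed

text \<open>Bounded degree enters here: \<open>N\<close> depends on \<open>k\<close> but not on
  \<open>n\<close>. It gives internal sets finite mass and bounds the number of colours needed
  later.\<close>

lemma gball_sections_bounded:
  "\<exists>N. \<forall>n x. finite {y. gdist (E n) x y \<le> enat k} \<and> card {y. gdist (E n) x y \<le> enat k} \<le> N"
proof -
  obtain D where "\<And>n x. x \<in> V n \<Longrightarrow> card {y. {x, y} \<in> E n} \<le> D"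
    using bounded by (auto simp: bounded_degree_def)
  then show ?thesis
    using card_gdist_ball_le[OF graph] by blast
qed

lemma mass_finite:
  assumes "S \<in> uniform"
  shows "mass S < \<infinity>"
proof -
  obtain k where k: "\<And>n. S n \<subseteq> gball k n"
    using assms by (auto simp: uniform_iff)
  obtain N where N: "\<And>n x. finite {y. gdist (E n) x y \<le> enat k}"
      "\<And>n x. card {y. gdist (E n) x y \<le> enat k} \<le> N"
    using gball_sections_bounded by blast
  have "density S n \<le> ennreal (real N)" for n
  proof -
    have "S n \<subseteq> (SIGMA x:V n. {y. gdist (E n) x y \<le> enat k})"
      using k by (auto simp: gball_def)
    then have "card (S n) \<le> card (SIGMA x:V n. {y. gdist (E n) x y \<le> enat k})"
      using N(1) by (intro card_mono) auto
    also have "\<dots> \<le> card (V n) * N"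
      using N sum_bounded_above[of "V n" "\<lambda>x. card {y. gdist (E n) x y \<le> enat k}" N] by simp
    finally have "real (card (S n)) \<le> real N * real (card (V n))"
      by (metis mult.commute of_nat_le_iff of_nat_mult)
    then show ?thesis
      by (intro ennreal_leI) (simp add: divide_le_eq card_gt_0_iff)
  qed
  then have "mass S \<le> ennreal (real N)"
    by (intro mass_le) simp
  then show ?thesis
    by (rule le_less_trans) simp
qed

text \<open>Otherwise pick \<open>p n\<close> in the first \<open>N n\<close> relations, with
  \<open>N n\<close> growing along \<open>U\<close>; the class of this sequence would lie in every
  set.\<close>

lemma internal_saturated:
  assumes S: "\<And>i. S i \<in> uniform" and dec: "decseq (\<lambda>i. internal (S i))"
    and empty: "(\<Inter>i. internal (S i)) = {}"
  shows "\<exists>i. internal (S i) = {}"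
proof (rule ccontr)
  assume nonempty: "\<not> ?thesis"
  \<comment> \<open>\<open>dec\<close> concerns the internal sets. At a fixed \<open>n\<close> the
    \<open>S j n\<close> need not be nested, hence the intersection over all
    \<open>j \<le> i\<close>.\<close>
  define P where "P i n \<longleftrightarrow> (\<Inter>j\<le>i. S j n) \<noteq> {}" for i n
  have "eventually (P i) U" for i
  proof -
    obtain p where p: "p \<in> internal (S i)"
      using nonempty by blast
    then obtain x y where xy: "p = (cls x, cls y)" "x \<in> Pi UNIV V" "y \<in> Pi UNIV V"
      by (auto simp: internal_rel_def)
    have "eventually (\<lambda>n. (x n, y n) \<in> S j n) U" if "j \<in> {..i}" for j
    proof -
      have "p \<in> internal (S j)"
        using p decseqD[OF dec, of j i] that by auto
      then show ?thesis
        using xy by (simp add: internal_iff)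
    qed
    then have "eventually (\<lambda>n. \<forall>j\<in>{..i}. (x n, y n) \<in> S j n) U"
      by (intro eventually_ball_finite) auto
    then show ?thesis
      by eventually_elim (auto simp: P_def)
  qed
  then obtain N where N: "eventually (\<lambda>n. P (N n) n) U" "\<And>i. eventually (\<lambda>n. i \<le> N n) U"
    using diagonal_choice[OF le_sequentially, of P] by blast
  have "\<exists>p. p \<in> V n \<times> V n \<and> (P (N n) n \<longrightarrow> p \<in> (\<Inter>j\<le>N n. S j n))" for n
  proof (cases "P (N n) n")
    case True
    then obtain p where p: "p \<in> (\<Inter>j\<le>N n. S j n)"
      by (auto simp: P_def)
    then have "p \<in> S 0 n" by auto
    with p uniform_subset[OF S, of 0 n] show ?thesis by blast
  qed (use V_nonempty[of n] in blast)
  then obtain p where p: "\<And>n. p n \<in> V n \<times> V n" "\<And>n. P (N n) n \<Longrightarrow> p n \<in> (\<Inter>j\<le>N n. S j n)"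
    by metis
  define x y where "x = fst \<circ> p" and "y = snd \<circ> p"
  have xy: "x \<in> Pi UNIV V" "y \<in> Pi UNIV V"
    using p(1) by (auto simp: x_def y_def mem_Times_iff)
  have "(cls x, cls y) \<in> internal (S i)" for i
  proof -
    have "eventually (\<lambda>n. (x n, y n) \<in> S i n) U"
      using N(1) N(2)[of i] by eventually_elim (use p(2) in \<open>auto simp: x_def y_def\<close>)
    then show ?thesis
      using xy by (simp add: internal_iff)
  qed
  with empty show False by blast
qed

text \<open>A countable union of internal sets need not be internal, but it has an internal cover:
  at index \<open>n\<close> join the first \<open>N n\<close> relations, where \<open>N n\<close> is
  limited by the density bound and tends to infinity along \<open>U\<close>. The strict hypothesis
  passes from the masses to the densities at almost all \<open>n\<close>.\<close>

lemma ex_internal_cover: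
  fixes T :: "nat \<Rightarrow> nat \<Rightarrow> ('a \<times> 'a) set"
  assumes T: "\<And>i n. T i n \<subseteq> gball k n"
    and c: "\<And>i. mass (\<lambda>n. \<Union>j\<le>i. T j n) < c"
  shows "\<exists>T'. (\<forall>n. T' n \<subseteq> gball k n) \<and> (\<forall>i. internal (T i) \<subseteq> internal T') \<and> mass T' \<le> c"
proof -
  define P where "P i n \<longleftrightarrow> density (\<lambda>n. \<Union>j\<le>i. T j n) n < c" for i n :: nat
  have "eventually (P i) U" for i
    unfolding P_def using c by (rule mass_less)
  then obtain N where N: "eventually (\<lambda>n. P (N n) n) U" "\<And>i. eventually (\<lambda>n. i \<le> N n) U"
    using diagonal_choice[OF le_sequentially, of P] by blast
  define T' where "T' n = (\<Union>j\<le>N n. T j n)" for n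
  show ?thesis
  proof (intro exI[of _ T'] conjI allI)
    show "T' n \<subseteq> gball k n" for n
      using T by (auto simp: T'_def)
    show "internal (T i) \<subseteq> internal T'" for i
    proof (subst internal_subset_iff)
      show "T i n \<subseteq> V n \<times> V n" for n
        using T[of i n] by (auto simp: gball_def)
      show "eventually (\<lambda>n. T i n \<subseteq> T' n) U"
        using N(2)[of i] by eventually_elim (auto simp: T'_def)
    qed
    show "mass T' \<le> c"
      using N(1) by (intro mass_le) (auto simp: P_def T'_def elim: eventually_mono)
  qed
qed

text \<open>Caratheodory's theorem in the form that requires continuity at the empty set. Saturation
  leaves nothing to estimate: a decreasing sequence of internal sets with empty intersection is
  eventually empty.\<close>

lemma loeb_extension:
  "\<exists>\<mu>. (\<forall>S\<in>uniform. \<mu> (internal S) = mass S)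
      \<and> measure_space groupoid (sigma_sets groupoid (internal ` uniform)) \<mu>"
proof -
  define f where "f A = mass (SOME S. S \<in> uniform \<and> internal S = A)" for A
  have f: "f (internal S) = mass S" if "S \<in> uniform" for S
  proof -
    have "(SOME S'. S' \<in> uniform \<and> internal S' = internal S) \<in> uniform \<and>
        internal (SOME S'. S' \<in> uniform \<and> internal S' = internal S) = internal S"
      by (rule someI[of _ S]) (simp add: that)
    then show ?thesis
      unfolding f_def using that by (intro mass_cong) auto
  qed
  have empty: "(\<lambda>n. {}) \<in> uniform"
    by (auto simp: uniform_iff)
  interpret ring_of_sets groupoid "internal ` uniform"
  proof (rule ring_of_setsI)
    show "internal ` uniform \<subseteq> Pow groupoid"
      using internal_subset_groupoid by auto
    show "{} \<in> internal ` uniform"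
      using empty internal_empty by blast
    show "a \<union> b \<in> internal ` uniform" "a - b \<in> internal ` uniform"
      if "a \<in> internal ` uniform" "b \<in> internal ` uniform" for a b
      using that uniform_Un uniform_Diff
      by (auto simp flip: internal_Un internal_Diff)
  qed
  have "\<exists>\<mu>. (\<forall>A\<in>internal ` uniform. \<mu> A = f A)
      \<and> measure_space groupoid (sigma_sets groupoid (internal ` uniform)) \<mu>"
  proof (rule caratheodory_empty_continuous)
    show "positive (internal ` uniform) f"
      using f[OF empty] by (simp add: positive_def internal_empty mass_empty)
    show "additive (internal ` uniform) f"
      unfolding additive_def
    proof (intro ballI impI)
      fix a b assume "a \<in> internal ` uniform" "b \<in> internal ` uniform" and ab: "a \<inter> b = {}"
      then obtain S T where ST: "S \<in> uniform" "T \<in> uniform" "a = internal S" "b = internal T"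
        by auto
      have "internal (\<lambda>n. S n \<inter> T n) \<subseteq> internal (\<lambda>n. {})"
        using ab ST by (simp add: internal_Int)
      then have "eventually (\<lambda>n. S n \<inter> T n \<subseteq> {}) U"
        using ST uniform_subset by (subst (asm) internal_subset_iff) auto
      then show "f (a \<union> b) = f a + f b"
        using ST by (simp add: f uniform_Un mass_Un flip: internal_Un)
    qed
    show "f A \<noteq> \<infinity>" if "A \<in> internal ` uniform" for A
      using that f mass_finite by (auto simp: less_top[symmetric])
    show "(\<lambda>i. f (A i)) \<longlonglongrightarrow> 0"
      if A: "range A \<subseteq> internal ` uniform" "decseq A" "(\<Inter>i. A i) = {}" for A
    proof -
      have "\<forall>i. \<exists>S. S \<in> uniform \<and> A i = internal S"
        using A(1) by blast
      then obtain S where S: "\<And>i. S i \<in> uniform" "\<And>i. A i = internal (S i)"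
        by metis
      then have "A = (\<lambda>i. internal (S i))"
        by auto
      then obtain i where i: "A i = {}"
        using internal_saturated[of S] S(1) A(2,3) by auto
      have "f (A j) = 0" if "j \<ge> i" for j
      proof -
        have "A j = {}"
          using decseqD[OF A(2) that] i by simp
        then show ?thesis
          using f[OF empty] by (simp add: internal_empty mass_empty)
      qed
      then show ?thesis
        by (intro tendsto_eventually) (auto simp: eventually_sequentially)
    qed
  qed
  then show ?thesis
    using f by auto
qed

lemma space_loeb: "space loeb = groupoid"
  unfolding loeb_def using internal_subset_groupoid by (intro space_extend_measure) auto

lemma sets_loeb: "sets loeb = sigma_sets groupoid (internal ` uniform)"
  unfolding loeb_def using internal_subset_groupoid by (intro sets_extend_measure) auto

lemma internal_sets [simp]: "S \<in> uniform \<Longrightarrow> internal S \<in> sets loeb"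
  unfolding sets_loeb by auto

text \<open>\<open>extend_measure\<close> is only known to take the prescribed values once some
  extension exists, which is what \<open>loeb_extension\<close> provides.\<close>

lemma emeasure_internal: "S \<in> uniform \<Longrightarrow> emeasure loeb (internal S) = mass S"
proof -
  assume S: "S \<in> uniform"
  obtain \<mu> where \<mu>: "\<And>S. S \<in> uniform \<Longrightarrow> \<mu> (internal S) = mass S"
      "measure_space groupoid (sigma_sets groupoid (internal ` uniform)) \<mu>"
    using loeb_extension by blast
  show ?thesis
    by (rule emeasure_extend_measure[where \<mu>' = \<mu>, OF loeb_def])
       (use \<mu> S internal_subset_groupoid in \<open>auto simp: sets_loeb measure_space_def\<close>)
qed

lemma ultra_groupoid_measure_eq: "ultra_groupoid_measure U V E = completion loeb"
  unfolding ultra_groupoid_measure_def loeb_def mass_def ..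

section \<open>Approximation of measurable sets by internal relations\<close>

lemma uniform_gballI: "(\<And>n. S n \<subseteq> gball k n) \<Longrightarrow> S \<in> uniform"
  by (auto simp: uniform_iff)

lemma emeasure_internal_finite: "S \<in> uniform \<Longrightarrow> emeasure loeb (internal S) < \<infinity>"
  using mass_finite by (simp add: emeasure_internal)

text \<open>The outer set is an internal cover of all \<open>T i\<close>, the inner one a union of
  finitely many \<open>S i\<close>. Half of \<open>e\<close> pays for the gaps between
  \<open>T i\<close> and \<open>S i\<close>, a quarter for the cover, and a quarter for cutting off
  the tail of the union.\<close>

lemma loeb_regular_UN:
  fixes e :: real
  assumes S: "\<And>i n. S i n \<subseteq> gball k n" and T: "\<And>i n. T i n \<subseteq> gball k n"
    and SA: "\<And>i. internal (S i) \<subseteq> A i" and AT: "\<And>i. A i \<inter> internal (gball k) \<subseteq> internal (T i)"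
    and TS: "\<And>i. emeasure loeb (internal (T i) - internal (S i)) \<le> ennreal (e / 2 * (1 / 2) ^ Suc i)"
    and e: "0 < e"
  shows "\<exists>S' T'. (\<forall>n. S' n \<subseteq> gball k n) \<and> (\<forall>n. T' n \<subseteq> gball k n)
    \<and> internal S' \<subseteq> (\<Union>i. A i) \<inter> internal (gball k) \<and> (\<Union>i. A i) \<inter> internal (gball k) \<subseteq> internal T'
    \<and> emeasure loeb (internal T' - internal S') \<le> ennreal e"
proof -
  let ?m = "emeasure loeb"
  define TU where "TU i n = (\<Union>j\<le>i. T j n)" for i n
  have Tu: "T i \<in> uniform" and Su: "S i \<in> uniform" and TUu: "TU i \<in> uniform" for i
    using S T by (intro uniform_gballI[of _ k]; fastforce simp: TU_def)+
  have TU_eq: "internal (TU i) = (\<Union>j\<le>i. internal (T j))" for i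
    unfolding TU_def by (rule internal_UN) simp
  define M where "M = ?m (\<Union>i. internal (T i))"
  have "(\<Union>i. internal (T i)) \<subseteq> internal (gball k)"
    using T by (intro UN_least internal_mono)
  then have "M \<le> ?m (internal (gball k))"
    unfolding M_def by (intro emeasure_mono) (auto simp: uniform_gball)
  then have M_fin: "M < \<infinity>"
    using emeasure_internal_finite[OF uniform_gball] by (rule le_less_trans)
  \<comment> \<open>Finiteness of \<open>M\<close> makes the slack strict, as
    \<open>ex_internal_cover\<close> needs a strict bound.\<close>
  then have M_less: "M < M + ennreal (e / 4)"
    using e ennreal_add_left_cancel_less[of M 0 "ennreal (e / 4)"] by simp
  have UN_TU: "(\<Union>i. internal (TU i)) = (\<Union>i. internal (T i))"
    unfolding TU_eq by blast
  have TU_le: "?m (internal (TU i)) \<le> M" for i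
    unfolding M_def by (intro emeasure_mono) (auto simp: TU_eq Tu)
  have "mass (\<lambda>n. \<Union>j\<le>i. T j n) < M + ennreal (e / 4)" for i
    using le_less_trans[OF TU_le[of i] M_less]
    by (simp add: emeasure_internal[OF TUu]) (simp add: TU_def[abs_def])
  from ex_internal_cover[OF T this]
  obtain T' where T': "\<And>n. T' n \<subseteq> gball k n" "\<And>i. internal (T i) \<subseteq> internal T'"
      "mass T' \<le> M + ennreal (e / 4)"
    by auto
  have T'u: "T' \<in> uniform"
    using T'(1) by (rule uniform_gballI)
  have "(\<lambda>i. ?m (internal (TU i))) \<longlonglongrightarrow> M"
    unfolding M_def UN_TU[symmetric]
  proof (rule Lim_emeasure_incseq)
    show "incseq (\<lambda>i. internal (TU i))"
      unfolding incseq_def TU_eq by (auto intro: order_trans)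
  qed (auto simp: TUu)
  then have "(\<lambda>i. ?m (internal (TU i)) + ennreal (e / 4)) \<longlonglongrightarrow> M + ennreal (e / 4)"
    by (intro tendsto_intros)
  then have "eventually (\<lambda>i. M < ?m (internal (TU i)) + ennreal (e / 4)) sequentially"
    using M_less by (rule order_tendstoD(1))
  \<comment> \<open>Continuity from below: the first \<open>T i\<close> carry all but
    \<open>e / 4\<close> of the measure of the union.\<close>
  then obtain i0 where i0: "M < ?m (internal (TU i0)) + ennreal (e / 4)"
    by (auto simp: eventually_sequentially)
  define S' where "S' n = (\<Union>j\<le>i0. S j n)" for n
  have S'_eq: "internal S' = (\<Union>j\<le>i0. internal (S j))"
    unfolding S'_def by (rule internal_UN) simp
  have TUT': "internal (TU i0) \<subseteq> internal T'"
    using T'(2) unfolding TU_eq by blast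
  have "?m (internal T') \<le> M + ennreal (e / 4)"
    using T'(3) by (simp add: emeasure_internal[OF T'u])
  also have "\<dots> \<le> (?m (internal (TU i0)) + ennreal (e / 4)) + ennreal (e / 4)"
    using i0 by (intro add_right_mono) simp
  also have "\<dots> = ?m (internal (TU i0)) + ennreal (e / 2)"
    using e by (simp add: add.assoc flip: ennreal_plus)
  finally have "?m (internal T') - ?m (internal (TU i0)) \<le> ennreal (e / 2)"
    using emeasure_internal_finite[OF TUu, of i0]
    by (metis ennreal_minus_le_iff infinity_ennreal_def less_irrefl)
  then have first: "?m (internal T' - internal (TU i0)) \<le> ennreal (e / 2)"
    using TUT' TUu T'u emeasure_internal_finite[OF TUu, of i0] by (subst emeasure_Diff) auto
  have "?m (\<Union>j\<le>i0. internal (T j) - internal (S j)) \<le> (\<Sum>j\<le>i0. ?m (internal (T j) - internal (S j)))"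
    by (intro emeasure_subadditive_finite) (auto simp: Tu Su)
  also have "\<dots> \<le> (\<Sum>j\<le>i0. ennreal (e / 2 * (1 / 2) ^ Suc j))"
    by (intro sum_mono TS)
  also have "\<dots> = ennreal (e / 2 * (\<Sum>j\<le>i0. (1 / 2) ^ Suc j))"
    using e by (subst sum_ennreal) (auto simp: sum_distrib_left)
  also have "\<dots> \<le> ennreal (e / 2 * 1)"
    using e half_powers_sum_le by (intro ennreal_leI mult_left_mono) auto
  finally have second: "?m (\<Union>j\<le>i0. internal (T j) - internal (S j)) \<le> ennreal (e / 2)"
    by simp
  have "?m (internal T' - internal S')
      \<le> ?m ((internal T' - internal (TU i0)) \<union> (\<Union>j\<le>i0. internal (T j) - internal (S j)))"
  proof (rule emeasure_mono)
    show "internal T' - internal S'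
        \<subseteq> (internal T' - internal (TU i0)) \<union> (\<Union>j\<le>i0. internal (T j) - internal (S j))"
      unfolding TU_eq S'_eq by blast
  qed (intro sets.Un sets.Diff sets.finite_UN internal_sets Tu Su T'u TUu finite_atMost)
  also have "\<dots> \<le> ?m (internal T' - internal (TU i0)) + ?m (\<Union>j\<le>i0. internal (T j) - internal (S j))"
    by (intro emeasure_subadditive sets.Diff sets.finite_UN internal_sets
        Tu Su T'u TUu finite_atMost)
  also have "\<dots> \<le> ennreal (e / 2) + ennreal (e / 2)"
    by (intro add_mono first second)
  also have "\<dots> = ennreal e"
    using e by (simp flip: ennreal_plus)
  finally have diff: "?m (internal T' - internal S') \<le> ennreal e" .
  have S'_gball: "S' n \<subseteq> gball k n" for n
    using S by (auto simp: S'_def)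
  show ?thesis
  proof (rule exI[of _ S'], rule exI[of _ T'], intro conjI allI S'_gball T'(1) diff)
    show "internal S' \<subseteq> (\<Union>i. A i) \<inter> internal (gball k)"
      using SA internal_mono[of S' "gball k", OF S'_gball] unfolding S'_eq by blast
    show "(\<Union>i. A i) \<inter> internal (gball k) \<subseteq> internal T'"
      using AT T'(2) by blast
  qed
qed

text \<open>The approximation is two-sided because complements, met in the induction over the
  sigma-algebra, exchange inner and outer sets. It is relative to a ball because the groupoid need
  be neither internal nor of finite measure. \<open>e\<close> varies in the induction: a union
  spends smaller tolerances on its members.\<close>

lemma loeb_regular:
  fixes e :: real
  assumes "A \<in> sets loeb" "0 < e"
  shows "\<exists>S T. (\<forall>n. S n \<subseteq> gball k n) \<and> (\<forall>n. T n \<subseteq> gball k n)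
    \<and> internal S \<subseteq> A \<inter> internal (gball k) \<and> A \<inter> internal (gball k) \<subseteq> internal T
    \<and> emeasure loeb (internal T - internal S) \<le> ennreal e"
  using assms unfolding sets_loeb
proof (induction A arbitrary: e rule: sigma_sets.induct)
  case (Basic a)
  then obtain S where "a = internal S" by auto
  then show ?case
    by (intro exI[of _ "\<lambda>n. S n \<inter> gball k n"]) (auto simp: internal_Int)
next
  case Empty
  show ?case
    by (intro exI[of _ "\<lambda>n. {}"]) (simp add: internal_empty)
next
  case (Compl a)
  from Compl.IH[OF Compl.prems] obtain S T
    where ST: "\<And>n. S n \<subseteq> gball k n" "\<And>n. T n \<subseteq> gball k n"
      "internal S \<subseteq> a \<inter> internal (gball k)" "a \<inter> internal (gball k) \<subseteq> internal T"
      "emeasure loeb (internal T - internal S) \<le> ennreal e"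
    by auto
  \<comment> \<open>Complementing inside the ball swaps the two approximations and does not enlarge
    the gap.\<close>
  have "emeasure loeb ((internal (gball k) - internal S) - (internal (gball k) - internal T))
      \<le> emeasure loeb (internal T - internal S)"
    using uniform_gballI[OF ST(1)] uniform_gballI[OF ST(2)] by (intro emeasure_mono) auto
  also note ST(5)
  finally have diff: "emeasure loeb (internal (\<lambda>n. gball k n - S n) - internal (\<lambda>n. gball k n - T n)) \<le> ennreal e"
    by (simp add: internal_Diff)
  have sub: "internal (\<lambda>n. gball k n - T n) \<subseteq> (groupoid - a) \<inter> internal (gball k)"
      "(groupoid - a) \<inter> internal (gball k) \<subseteq> internal (\<lambda>n. gball k n - S n)"
    using ST(3,4) internal_subset_groupoid[OF uniform_gball, of k] by (auto simp: internal_Diff)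
  show ?case
    by (rule exI[of _ "\<lambda>n. gball k n - T n"], rule exI[of _ "\<lambda>n. gball k n - S n"])
       (intro conjI allI Diff_subset sub diff)
next
  case (Union A)
  have "\<forall>i. \<exists>S T. (\<forall>n. S n \<subseteq> gball k n) \<and> (\<forall>n. T n \<subseteq> gball k n)
    \<and> internal S \<subseteq> A i \<inter> internal (gball k) \<and> A i \<inter> internal (gball k) \<subseteq> internal T
    \<and> emeasure loeb (internal T - internal S) \<le> ennreal (e / 2 * (1 / 2) ^ Suc i)"
    using Union.prems by (intro allI Union.IH) auto
  then obtain S T where ST: "\<And>i n. S i n \<subseteq> gball k n" "\<And>i n. T i n \<subseteq> gball k n"
    "\<And>i. internal (S i) \<subseteq> A i \<inter> internal (gball k)"
    "\<And>i. A i \<inter> internal (gball k) \<subseteq> internal (T i)"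
    "\<And>i. emeasure loeb (internal (T i) - internal (S i)) \<le> ennreal (e / 2 * (1 / 2) ^ Suc i)"
    by metis
  show ?case
    by (rule loeb_regular_UN[of S k T A, OF ST(1,2) _ ST(4,5) Union.prems]) (use ST(3) in blast)
qed

lemma ex_internal_superset:
  fixes e :: real
  assumes A: "A \<in> sets loeb" "A \<subseteq> internal (gball k)" and e: "0 < e"
  shows "\<exists>T\<in>uniform. A \<subseteq> internal T \<and> mass T \<le> emeasure loeb A + ennreal e"
proof -
  obtain S T where ST: "\<And>n. S n \<subseteq> gball k n" "\<And>n. T n \<subseteq> gball k n"
    "internal S \<subseteq> A" "A \<subseteq> internal T" "emeasure loeb (internal T - internal S) \<le> ennreal e"
    using loeb_regular[OF A(1) e, of k] A(2) by (auto simp: Int_absorb2)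
  have u: "S \<in> uniform" "T \<in> uniform"
    using uniform_gballI[OF ST(1)] uniform_gballI[OF ST(2)] .
  have "mass T = emeasure loeb (internal T)"
    by (simp add: emeasure_internal u)
  also have "\<dots> \<le> emeasure loeb (internal S \<union> (internal T - internal S))"
    using u by (intro emeasure_mono) auto
  also have "\<dots> \<le> emeasure loeb (internal S) + emeasure loeb (internal T - internal S)"
    using u by (intro emeasure_subadditive) auto
  also have "\<dots> \<le> emeasure loeb A + ennreal e"
    using A(1) ST by (intro add_mono emeasure_mono) auto
  finally show ?thesis
    using u(2) ST(4) by blast
qed

text \<open>Enlarging a graphing to internal relations destroys injectivity. This does no harm: the
  competing graphs only count pairs, and whatever the graphing reaches is still reached.\<close>

lemma ex_internal_covering_sequence:
  fixes e :: real
  assumes \<Phi>: "\<And>i. \<Phi> i \<in> sets (completion loeb)" and e: "0 < e"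
  shows "\<exists>T. (\<forall>j. T j \<in> uniform) \<and> (\<Union>i. \<Phi> i) \<subseteq> (\<Union>j. internal (T j))
    \<and> (\<Sum>j. mass (T j)) \<le> (\<Sum>i. emeasure (completion loeb) (\<Phi> i)) + ennreal e"
proof -
  have "\<forall>i. \<exists>A. A \<in> sets loeb \<and> \<Phi> i \<subseteq> A \<and> emeasure (completion loeb) (\<Phi> i) = emeasure loeb A"
    using completion_upper[OF \<Phi>] by blast
  then obtain A where A: "\<And>i. A i \<in> sets loeb" "\<And>i. \<Phi> i \<subseteq> A i"
      "\<And>i. emeasure (completion loeb) (\<Phi> i) = emeasure loeb (A i)"
    by metis
  define B where "B k = internal (gball k)" for k
  \<comment> \<open>Outer approximation is available only inside a ball. Cutting by the disjoint
    shells, rather than by the balls, keeps the measures of the pieces summing to that of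
    \<open>A i\<close>.\<close>
  define C where "C = (\<lambda>(i, k). A i \<inter> disjointed B k)"
  have B: "range B \<subseteq> sets loeb"
    by (auto simp: B_def uniform_gball)
  have C: "C p \<in> sets loeb" "C p \<subseteq> internal (gball (snd p))" for p
    using A(1) sets.range_disjointed_sets[OF B] disjointed_subset[of B "snd p"]
    by (auto simp: C_def B_def split: prod.split)
  have C_UN: "(\<Union>k. C (i, k)) = A i" for i
  proof -
    have "(\<Union>k. C (i, k)) = A i \<inter> (\<Union>k. B k)"
      unfolding C_def by (simp add: UN_disjointed_eq flip: Int_UN_distrib)
    then show ?thesis
      using sets.sets_into_space[OF A(1)[of i]] by (auto simp: space_loeb groupoid_eq B_def)
  qed
  have sum_C: "emeasure loeb (A i) = (\<Sum>k. emeasure loeb (C (i, k)))" for i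
  proof (subst suminf_emeasure)
    show "disjoint_family (\<lambda>k. C (i, k))"
      using disjoint_family_disjointed[of B] by (auto simp: C_def disjoint_family_on_def)
  qed (use C C_UN in auto)
  have "\<forall>j. \<exists>T. T \<in> uniform \<and> C (prod_decode j) \<subseteq> internal T
      \<and> mass T \<le> emeasure loeb (C (prod_decode j)) + ennreal (e * (1 / 2) ^ Suc j)"
    using ex_internal_superset[OF C] e by (auto simp: Bex_def)
  then obtain T where T: "\<And>j. T j \<in> uniform" "\<And>j. C (prod_decode j) \<subseteq> internal (T j)"
      "\<And>j. mass (T j) \<le> emeasure loeb (C (prod_decode j)) + ennreal (e * (1 / 2) ^ Suc j)"
    by metis
  have "(\<Sum>j. mass (T j))
      \<le> (\<Sum>j. emeasure loeb (C (prod_decode j)) + ennreal (e * (1 / 2) ^ Suc j))"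
    by (intro suminf_le T(3)) auto
  also have "\<dots> = (\<Sum>j. emeasure loeb (C (prod_decode j))) + (\<Sum>j. ennreal (e * (1 / 2) ^ Suc j))"
    by (intro suminf_add[symmetric]) auto
  also have "(\<Sum>j. emeasure loeb (C (prod_decode j))) = (\<Sum>i. emeasure loeb (A i))"
    using sum_C by (intro suminf_ennreal_2dimen) auto
  also have "(\<Sum>j. ennreal (e * (1 / 2) ^ Suc j)) = ennreal (e * 1)"
    using e power_half_series by (intro suminf_ennreal_eq sums_mult) auto
  finally have "(\<Sum>j. mass (T j)) \<le> (\<Sum>i. emeasure (completion loeb) (\<Phi> i)) + ennreal e"
    by (simp add: A(3))
  moreover have "(\<Union>i. \<Phi> i) \<subseteq> (\<Union>j. internal (T j))"
  proof
    fix p assume "p \<in> (\<Union>i. \<Phi> i)"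
    then obtain i where "p \<in> A i"
      using A(2) by blast
    then obtain k where "p \<in> C (i, k)"
      using C_UN[of i] by blast
    then have "p \<in> internal (T (prod_encode (i, k)))"
      using T(2)[of "prod_encode (i, k)"] by auto
    then show "p \<in> (\<Union>j. internal (T j))" by blast
  qed
  ultimately show ?thesis
    using T(1) by blast
qed

subsection \<open>From graphings to Lipschitz equivalent graphs\<close>

text \<open>\<open>U\<close> refines the cofinite filter, so a bound at \<open>U\<close>-almost all
  \<open>n\<close> holds infinitely often, which is enough for a lower limit.\<close>

lemma combinatorial_cost_le:
  assumes "eventually (\<lambda>n. cost_at_scale L (V n) (E n) \<le> c) U"
  shows "combinatorial_cost V E \<le> c"
proof -
  have "liminf (\<lambda>n. cost_at_scale L (V n) (E n)) \<le> c"
  proof (rule ccontr)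
    assume "\<not> ?thesis"
    then have "c < liminf (\<lambda>n. cost_at_scale L (V n) (E n))"
      by simp
    then have "eventually (\<lambda>n. c < cost_at_scale L (V n) (E n)) sequentially"
      by (rule less_LiminfD)
    then have "eventually (\<lambda>n. c < cost_at_scale L (V n) (E n)) U"
      by (rule filter_leD[OF le_sequentially])
    with assms have "eventually (\<lambda>n. False) U"
      by eventually_elim simp
    then show False by simp
  qed
  then show ?thesis
    unfolding combinatorial_cost_def by (rule INF_lower2[OF UNIV_I])
qed

definition edge_rel :: "nat \<Rightarrow> ('a \<times> 'a) set" where
  "edge_rel n = adj (E n)"

lemma edge_rel_subset_gball: "edge_rel n \<subseteq> gball 1 n"
  using edge_in_V gdist_le_1 by (fastforce simp: edge_rel_def gball_def)

lemma uniform_edge_rel: "edge_rel \<in> uniform"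
  using edge_rel_subset_gball by (rule uniform_gballI)

text \<open>Inverses are included because generated equivalences are symmetric, loops in order to
  pad walks to a fixed length. Only finitely many relations are joined, so that the result stays
  internal.\<close>

definition step_rel :: "(nat \<Rightarrow> nat \<Rightarrow> ('a \<times> 'a) set) \<Rightarrow> nat \<Rightarrow> nat \<Rightarrow> ('a \<times> 'a) set" where
  "step_rel T m n = Id_on (V n) \<union> (\<Union>j<m. T j n \<union> (T j n)\<inverse>)"

lemma uniform_step_rel:
  assumes "\<And>j. T j \<in> uniform"
  shows "step_rel T m \<in> uniform"
  unfolding step_rel_def[abs_def]
  by (intro uniform_Un uniform_Id_on uniform_UN uniform_converse assms) auto

lemma internal_step_rel:
  "internal (step_rel T m) = Id_on units \<union> (\<Union>j<m. internal (T j) \<union> (internal (T j))\<inverse>)"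
  unfolding step_rel_def[abs_def]
  by (simp add: internal_Un internal_Id_on internal_UN internal_converse)

lemma equiv_internal_step_rel:
  "equiv units (\<Union>m. internal (step_rel T m) ^^ Suc m)"
proof (rule equiv_UN_relpow)
  show "mono (\<lambda>m. internal (step_rel T m))"
    unfolding internal_step_rel by (rule monoI) (auto intro: less_le_trans)
  show "sym (internal (step_rel T m))" for m
    unfolding internal_step_rel by (auto simp: sym_def)
  show "Id_on units \<subseteq> internal (step_rel T 0)"
    unfolding internal_step_rel by blast
qed (rule internal_subset_units)

text \<open>The competing graph consists of the pairs in \<open>T\<^sub>0, \<dots>, T\<^bsub>m-1\<^esub>\<close> and of those edges that are not
  reached by \<open>m + 1\<close> steps along them.\<close>

lemma cost_at_scale_le_step_rel:
  assumes T: "\<And>j n. j < m \<Longrightarrow> T j n \<subseteq> gball k n"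
  shows "cost_at_scale (k + m + 1) (V n) (E n)
    \<le> (\<Sum>j<m. density (T j) n) + density (\<lambda>n. edge_rel n - step_rel T m n ^^ Suc m) n"
proof -
  let ?R = "edge_rel n - step_rel T m n ^^ Suc m"
  \<comment> \<open>\<open>k\<close> bounds the \<open>E n\<close>-distance across pairs of
    \<open>T j n\<close>, and \<open>m + 1\<close> the walks in \<open>F\<close> that replace edges.
    The sum is at least 1, as the exceptional edges require in both directions.\<close>
  let ?L = "k + m + 1"
  define P where "P = (\<Union>j<m. T j n) \<union> ?R"
  \<comment> \<open>\<open>T j n\<close> may contain loops, while \<open>F\<close> has to be a
    simple graph.\<close>
  define F where "F = (\<lambda>(x, y). {x, y}) ` {(x, y) \<in> P. x \<noteq> y}"
  have P_gball: "P \<subseteq> gball ?L n"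
  proof -
    have "T j n \<subseteq> gball ?L n" if "j < m" for j
      using T[OF that] gball_mono[of k ?L n] by (rule subset_trans) simp
    moreover have "edge_rel n \<subseteq> gball ?L n"
      using edge_rel_subset_gball gball_mono[of 1 ?L n] by (rule subset_trans) simp
    ultimately show ?thesis
      unfolding P_def by blast
  qed
  have finP: "finite P"
    using P_gball uniform_finite[OF uniform_gball] by (rule finite_subset)
  have F_iff: "{x, y} \<in> F \<longleftrightarrow> x \<noteq> y \<and> ((x, y) \<in> P \<or> (y, x) \<in> P)" for x y
    unfolding F_def by (auto simp: image_iff doubleton_eq_iff)
  have "finite_graph (V n) F"
    using P_gball unfolding finite_graph_def F_def gball_def by auto
  moreover have "lipschitz_equivalent ?L (E n) F"
    unfolding lipschitz_equivalent_def
  proof (intro conjI allI impI)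
    fix x y assume "{x, y} \<in> F"
    then have "(x, y) \<in> gball ?L n \<or> (y, x) \<in> gball ?L n"
      using P_gball by (auto simp: F_iff)
    then show "gdist (E n) x y \<le> enat ?L"
      using gdist_commute[of "E n" x y] by (auto simp: gball_def)
  next
    fix x y assume xy: "{x, y} \<in> E n"
    have step: "gdist F u v \<le> enat 1" if "(u, v) \<in> step_rel T m n" for u v
    proof (cases "u = v")
      case False
      then have "{u, v} \<in> F"
        using that by (auto simp: F_iff step_rel_def P_def)
      then show ?thesis by (rule gdist_le_1)
    qed simp
    show "gdist F x y \<le> enat ?L"
    proof (cases "(x, y) \<in> step_rel T m n ^^ Suc m")
      case True
      have "gdist F x y \<le> enat (Suc m * 1)"
        by (rule gdist_relpow[OF step True])
      also have "\<dots> \<le> enat ?L" by simp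
      finally show ?thesis .
    next
      case False
      then have "{x, y} \<in> F"
        using xy edge_in_V[OF xy] by (auto simp: F_iff P_def edge_rel_def)
      then have "gdist F x y \<le> enat 1" by (rule gdist_le_1)
      also have "\<dots> \<le> enat ?L" by simp
      finally show ?thesis .
    qed
  qed
  ultimately have cost: "cost_at_scale ?L (V n) (E n) \<le> ennreal (real (card F) / real (card (V n)))"
    unfolding cost_at_scale_def by (intro INF_lower) simp
  have "card F \<le> card {(x, y) \<in> P. x \<noteq> y}"
    unfolding F_def by (intro card_image_le finite_subset[OF _ finP]) auto
  also have "\<dots> \<le> card P"
    by (intro card_mono finP) auto
  also have "\<dots> \<le> card (\<Union>j<m. T j n) + card ?R"
    unfolding P_def by (rule card_Un_le)
  also have "\<dots> \<le> (\<Sum>j<m. card (T j n)) + card ?R"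
    by (intro add_right_mono card_UN_le) simp
  finally have "real (card F) \<le> (\<Sum>j<m. real (card (T j n))) + real (card ?R)"
    by (metis of_nat_add of_nat_le_iff of_nat_sum)
  then have "real (card F) / real (card (V n))
      \<le> (\<Sum>j<m. real (card (T j n)) / real (card (V n))) + real (card ?R) / real (card (V n))"
    unfolding sum_divide_distrib[symmetric] add_divide_distrib[symmetric]
    by (rule divide_right_mono) simp
  then have "ennreal (real (card F) / real (card (V n)))
      \<le> ennreal ((\<Sum>j<m. real (card (T j n)) / real (card (V n))) + real (card ?R) / real (card (V n)))"
    by (rule ennreal_leI)
  also have "\<dots> = (\<Sum>j<m. density (T j) n) + density (\<lambda>n. edge_rel n - step_rel T m n ^^ Suc m) n"
    by (subst ennreal_plus) (simp_all add: sum_nonneg sum_ennreal)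
  finally show ?thesis
    using cost by (rule order_trans[rotated])
qed

lemma combinatorial_cost_le_ultra_groupoid_cost:
  "combinatorial_cost V E \<le> ultra_groupoid_cost U V E"
  unfolding ultra_groupoid_cost_def cost_def ultra_groupoid_measure_eq
proof (rule INF_greatest, rule ennreal_le_epsilon)
  fix \<Phi> and e :: real
  assume "\<Phi> \<in> {\<Phi>. graphing (completion loeb) \<Phi> \<and> generating units (completion loeb) \<Phi>}"
    and fin: "graphing_cost (completion loeb) \<Phi> < top" and e: "0 < e"
  then have \<Phi>: "\<And>i. \<Phi> i \<in> sets (completion loeb)"
    and gen: "sym_diff (generated_equiv units \<Phi>) groupoid \<in> null_sets (completion loeb)"
    by (auto simp: graphing_def bisection_def generating_def space_loeb)
  let ?c = "graphing_cost (completion loeb) \<Phi>"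
  \<comment> \<open>One third for covering the graphing, one for the missed edges, one to make the
    total strict, so that the bound passes to almost all \<open>n\<close>.\<close>
  have "0 < e / 3" using e by simp
  from ex_internal_covering_sequence[of \<Phi>, OF \<Phi> this]
  obtain T where T: "\<And>j. T j \<in> uniform" "(\<Union>i. \<Phi> i) \<subseteq> (\<Union>j. internal (T j))"
    and sumT: "(\<Sum>j. mass (T j)) \<le> ?c + ennreal (e / 3)"
    unfolding graphing_cost_def by auto
  define W where "W m = internal (step_rel T m) ^^ Suc m" for m
  have W_int: "W m = internal (\<lambda>n. step_rel T m n ^^ Suc m)" for m
    unfolding W_def using internal_relpow[OF uniform_subset[OF uniform_step_rel[OF T(1)]]] by simp
  have W_unif: "(\<lambda>n. step_rel T m n ^^ Suc m) \<in> uniform" for m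
    by (intro uniform_relpow uniform_step_rel T)
  have W_sets: "W m \<in> sets loeb" for m
    unfolding W_int by (rule internal_sets[OF W_unif])
  have "\<Phi> i \<subseteq> (\<Union>m. W m)" for i
  proof
    fix p assume "p \<in> \<Phi> i"
    then obtain j where "p \<in> internal (T j)"
      using T(2) by blast
    then have "p \<in> internal (step_rel T (Suc j))"
      unfolding internal_step_rel by blast
    moreover have "internal (step_rel T (Suc j)) ^^ Suc 0 \<subseteq> W (Suc j)"
      unfolding W_def
      by (rule relpow_Suc_mono_refl[OF _ internal_subset_units]) (auto simp: internal_step_rel)
    ultimately show "p \<in> (\<Union>m. W m)" by auto
  qed
  with equiv_internal_step_rel[of T] have "generated_equiv units \<Phi> \<subseteq> (\<Union>m. W m)"
    unfolding W_def by (rule generated_equiv_subset)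
  \<comment> \<open>The null set of the hypothesis is null only for the completion, but the part of
    the groupoid missed by all \<open>W m\<close> is measurable for \<open>loeb\<close>, hence null
    there.\<close>
  then have "groupoid - (\<Union>m. W m) \<subseteq> sym_diff (generated_equiv units \<Phi>) groupoid"
    by blast
  moreover have "groupoid - (\<Union>m. W m) \<in> sets loeb"
    using W_sets sets.top[of loeb] by (auto simp: space_loeb)
  ultimately have null: "groupoid - (\<Union>m. W m) \<in> null_sets loeb"
    using gen unfolding null_sets_completion_iff2
    by (meson null_sets_subset subset_trans)
  define D where "D m = (\<lambda>n. edge_rel n - step_rel T m n ^^ Suc m)" for m
  have D_unif: "D m \<in> uniform" for m
    unfolding D_def by (rule uniform_Diff[OF uniform_edge_rel])
  have D_eq: "internal (D m) = internal edge_rel - W m" for m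
    unfolding D_def W_int by (rule internal_Diff)
  \<comment> \<open>Continuity from above, available because the edges have finite mass: the edges
    missed by \<open>W m\<close> decrease to a null set.\<close>
  have "(\<lambda>m. emeasure loeb (internal (D m))) \<longlonglongrightarrow> emeasure loeb (\<Inter>m. internal (D m))"
  proof (rule Lim_emeasure_decseq)
    have "W k \<subseteq> W l" if "k \<le> l" for k l
      unfolding W_def
      by (rule relpow_Suc_mono_refl[OF _ internal_subset_units _ that])
         (use that in \<open>auto simp: internal_step_rel intro: less_le_trans\<close>)
    then show "decseq (\<lambda>m. internal (D m))"
      unfolding decseq_def D_eq by blast
    show "emeasure loeb (internal (D m)) \<noteq> \<infinity>" for m
      using emeasure_internal_finite[OF D_unif[of m]] by simp
  qed (auto simp: D_unif)
  moreover have "(\<Inter>m. internal (D m)) \<subseteq> groupoid - (\<Union>m. W m)"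
    unfolding D_eq using internal_subset_groupoid[OF uniform_edge_rel] by blast
  then have "emeasure loeb (\<Inter>m. internal (D m)) \<le> emeasure loeb (groupoid - (\<Union>m. W m))"
    using null by (intro emeasure_mono) auto
  then have "emeasure loeb (\<Inter>m. internal (D m)) = 0"
    unfolding null_setsD1[OF null] by simp
  ultimately have "(\<lambda>m. mass (D m)) \<longlonglongrightarrow> 0"
    by (simp add: emeasure_internal D_unif)
  then have "eventually (\<lambda>m. mass (D m) < ennreal (e / 3)) sequentially"
    by (rule order_tendstoD(2)) (use e in simp)
  then obtain m where m: "mass (D m) < ennreal (e / 3)"
    by (auto simp: eventually_sequentially)
  \<comment> \<open>Finitely many uniform relations share a radius \<open>k\<close>, so the scale
    \<open>k + m + 1\<close> does not depend on \<open>n\<close>.\<close>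
  have "(\<lambda>n. \<Union>j\<in>{..<m}. T j n) \<in> uniform"
    by (intro uniform_UN T) auto
  then obtain k where k: "\<And>n. (\<Union>j<m. T j n) \<subseteq> gball k n"
    unfolding uniform_iff by blast
  have lim: "((\<lambda>n. (\<Sum>j<m. density (T j) n) + density (D m) n)
      \<longlongrightarrow> (\<Sum>j<m. mass (T j)) + mass (D m)) U"
    by (intro tendsto_add tendsto_sum mass_tendsto)
  have "(\<Sum>j<m. mass (T j)) + mass (D m) \<le> (?c + ennreal (e / 3)) + ennreal (e / 3)"
    using sum_le_suminf[of "\<lambda>j. mass (T j)" "{..<m}"] sumT m by (intro add_mono) auto
  also have "\<dots> = ?c + ennreal (2 * e / 3)"
    using e by (simp add: add.assoc flip: ennreal_plus)
  also have "\<dots> < ?c + ennreal e"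
    using fin e by (simp add: ennreal_add_left_cancel_less ennreal_less_iff)
  finally have "eventually (\<lambda>n. (\<Sum>j<m. density (T j) n) + density (D m) n < ?c + ennreal e) U"
    by (rule order_tendstoD(2)[OF lim])
  then have "eventually (\<lambda>n. cost_at_scale (k + m + 1) (V n) (E n) \<le> ?c + ennreal e) U"
  proof eventually_elim
    case (elim n)
    have "cost_at_scale (k + m + 1) (V n) (E n) \<le> (\<Sum>j<m. density (T j) n) + density (D m) n"
      unfolding D_def by (rule cost_at_scale_le_step_rel) (use k in blast)
    with elim show ?case by simp
  qed
  then show "combinatorial_cost V E \<le> ?c + ennreal e"
    by (rule combinatorial_cost_le)
qed

subsection \<open>From Lipschitz equivalent graphs to graphings\<close>

lemma internal_pairE:
  assumes "p \<in> internal S"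
  obtains x y where "p = (cls x, cls y)" "x \<in> Pi UNIV V" "y \<in> Pi UNIV V"
    "eventually (\<lambda>n. (x n, y n) \<in> S n) U"
  using assms unfolding internal_rel_def by blast

lemma inj_on_fst_internal:
  assumes "\<And>n. inj_on fst (S n)"
  shows "inj_on fst (internal S)"
proof (rule inj_onI)
  fix p q assume "p \<in> internal S" "q \<in> internal S" and eq: "fst p = fst q"
  then obtain x y x' y' where p: "p = (cls x, cls y)" "q = (cls x', cls y')"
    and xy: "x \<in> Pi UNIV V" "y \<in> Pi UNIV V" "x' \<in> Pi UNIV V" "y' \<in> Pi UNIV V"
    and ev: "eventually (\<lambda>n. (x n, y n) \<in> S n) U" "eventually (\<lambda>n. (x' n, y' n) \<in> S n) U"
    by (elim internal_pairE)
  have "eventually (\<lambda>n. x n = x' n) U"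
    using eq p xy by (simp add: cls_eq_iff)
  with ev have "eventually (\<lambda>n. y n = y' n) U"
  proof eventually_elim
    case (elim n)
    then show ?case
      using inj_onD[OF assms[of n], of "(x n, y n)" "(x' n, y' n)"] by simp
  qed
  then show "p = q"
    using eq p xy by (simp add: cls_eq_iff)
qed

lemma inj_on_snd_internal:
  assumes "\<And>n. inj_on snd (S n)"
  shows "inj_on snd (internal S)"
proof (rule inj_onI)
  fix p q assume "p \<in> internal S" "q \<in> internal S" and eq: "snd p = snd q"
  then obtain x y x' y' where p: "p = (cls x, cls y)" "q = (cls x', cls y')"
    and xy: "x \<in> Pi UNIV V" "y \<in> Pi UNIV V" "x' \<in> Pi UNIV V" "y' \<in> Pi UNIV V"
    and ev: "eventually (\<lambda>n. (x n, y n) \<in> S n) U" "eventually (\<lambda>n. (x' n, y' n) \<in> S n) U"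
    by (elim internal_pairE)
  have "eventually (\<lambda>n. y n = y' n) U"
    using eq p xy by (simp add: cls_eq_iff)
  with ev have "eventually (\<lambda>n. x n = x' n) U"
  proof eventually_elim
    case (elim n)
    then show ?case
      using inj_onD[OF assms[of n], of "(x n, y n)" "(x' n, y' n)"] by simp
  qed
  then show "p = q"
    using eq p xy by (simp add: cls_eq_iff)
qed

lemma equiv_groupoid: "equiv units groupoid"
proof (rule equivI)
  show "refl_on units groupoid"
    using internal_subset_groupoid[OF uniform_Id_on] unfolding internal_Id_on refl_on_def
    by blast
  show "sym groupoid"
  proof (rule symI)
    fix x y assume "(x, y) \<in> groupoid"
    then obtain k where "(y, x) \<in> (internal (gball k))\<inverse>"
      unfolding groupoid_eq by blast
    then show "(y, x) \<in> groupoid"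
      using internal_subset_groupoid[OF uniform_converse[OF uniform_gball]]
      unfolding internal_converse[symmetric] by blast
  qed
  show "trans groupoid"
  proof (rule transI)
    fix x y z assume "(x, y) \<in> groupoid" "(y, z) \<in> groupoid"
    then obtain k l where kl: "(x, z) \<in> internal (gball k) O internal (gball l)"
      unfolding groupoid_eq by blast
    have "gball k n O gball l n \<subseteq> gball (k + l) n" for n
      by (auto simp: gball_def intro: gdist_triangle)
    then have "internal (\<lambda>n. gball k n O gball l n) \<subseteq> internal (gball (k + l))"
      by (rule internal_mono)
    with kl show "(x, z) \<in> groupoid"
      unfolding groupoid_eq internal_relcomp[OF uniform_subset[OF uniform_gball], symmetric] by blast
  qed
qed (rule groupoid_subset_units)

text \<open>Lying in balls of one radius makes \<open>Q\<close> uniform and bounds the number of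
  colours; the path condition makes the colour classes generate. The classes partition
  \<open>Q n\<close>, so their masses add up to the limit of the densities of
  \<open>Q\<close>.\<close>

lemma ultra_groupoid_cost_le_of_relations:
  assumes Q: "\<And>n. Q n \<subseteq> gball L n"
    and density: "eventually (\<lambda>n. density Q n \<le> c) U"
    and path: "eventually (\<lambda>n. \<forall>x y. {x, y} \<in> E n \<longrightarrow> gdist ((\<lambda>(x, y). {x, y}) ` Q n) x y \<le> enat L) U"
  shows "ultra_groupoid_cost U V E \<le> c"
proof -
  obtain N where N: "\<And>n x. finite {y. gdist (E n) x y \<le> enat L}"
      "\<And>n x. card {y. gdist (E n) x y \<le> enat L} \<le> N"
    using gball_sections_bounded by blast
  have "\<forall>n. \<exists>g. (\<forall>p\<in>Q n. g p < N * N)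
    \<and> (\<forall>i. inj_on fst {p \<in> Q n. g p = i} \<and> inj_on snd {p \<in> Q n. g p = i})"
  proof (intro allI ex_coloring_partial_injections conjI)
    fix n x
    have sub: "{y. (x, y) \<in> Q n} \<subseteq> {y. gdist (E n) x y \<le> enat L}"
      using Q[of n] by (auto simp: gball_def)
    show "finite {y. (x, y) \<in> Q n}"
      using sub N(1) by (rule finite_subset)
    show "card {y. (x, y) \<in> Q n} \<le> N"
      using card_mono[OF N(1) sub] N(2)[of n x] by (rule order_trans)
  next
    fix n y
    have sub: "{x. (x, y) \<in> Q n} \<subseteq> {x. gdist (E n) y x \<le> enat L}"
      using Q[of n] by (auto simp: gball_def gdist_commute)
    show "finite {x. (x, y) \<in> Q n}"
      using sub N(1) by (rule finite_subset)
    show "card {x. (x, y) \<in> Q n} \<le> N"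
      using card_mono[OF N(1) sub] N(2)[of n y] by (rule order_trans)
  qed
  from choice[OF this] obtain g where g: "\<And>n p. p \<in> Q n \<Longrightarrow> g n p < N * N"
      "\<And>n i. inj_on fst {p \<in> Q n. g n p = i}" "\<And>n i. inj_on snd {p \<in> Q n. g n p = i}"
    by blast
  define K where "K = N * N"
  define S where "S i n = {p \<in> Q n. g n p = i}" for i n
  have S_unif: "S i \<in> uniform" for i
    using Q by (intro uniform_gballI[of _ L]) (auto simp: S_def)
  have finQ: "finite (Q n)" for n
    using uniform_finite[OF uniform_gballI[of Q, OF Q]] .
  have graphing: "graphing (completion loeb) (\<lambda>i. internal (S i))"
    unfolding graphing_def bisection_def
    using S_unif g(2,3) by (auto simp: S_def intro!: inj_on_fst_internal inj_on_snd_internal)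
  \<comment> \<open>In this direction the equality is exact; no null set is discarded.\<close>
  have "generated_equiv units (\<lambda>i. internal (S i)) = groupoid"
  proof
    show "generated_equiv units (\<lambda>i. internal (S i)) \<subseteq> groupoid"
      by (intro generated_equiv_subset equiv_groupoid internal_subset_groupoid S_unif)
    show "groupoid \<subseteq> generated_equiv units (\<lambda>i. internal (S i))"
      unfolding generated_equiv_def
    proof (intro Inter_greatest, clarify)
      fix R assume R: "equiv units R" "\<forall>i. internal (S i) \<subseteq> R"
      have "internal (step_rel S K) \<subseteq> R"
      proof -
        have "R\<inverse> = R" and Id: "Id_on units \<subseteq> R"
          using R(1) by (auto simp: equiv_def sym_conv_converse_eq refl_on_def)
        then have "(internal (S i))\<inverse> \<subseteq> R" for i
          using R(2) by (metis converse_mono)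
        with Id R(2) show ?thesis
          unfolding internal_step_rel by blast
      qed
      then have step: "internal (step_rel S K) ^^ Suc m \<subseteq> R" for m
        using relpow_subset_relpow[of "internal (step_rel S K)" R "Suc m"]
          trans_relpow_Suc_subset[of R m] R(1) by (auto simp only: equiv_def)
      have "internal (gball k) \<subseteq> R" for k
      proof -
        \<comment> \<open>At most \<open>k\<close> edges of \<open>E n\<close>, each replaced by at
          most \<open>L\<close> steps. The exponent is one larger because only successor powers
          commute with \<open>internal\<close>; a loop at \<open>x\<close> fills the spare
          step.\<close>
        have "eventually (\<lambda>n. gball k n \<subseteq> step_rel S K n ^^ Suc (k * L)) U"
          using path
        proof eventually_elim
          case (elim n)
          let ?F = "(\<lambda>(x, y). {x, y}) ` Q n"
          have adj_F: "adj ?F \<subseteq> step_rel S K n"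
          proof (rule subrelI)
            fix x y assume "(x, y) \<in> adj ?F"
            then have "(x, y) \<in> Q n \<or> (y, x) \<in> Q n"
              by (auto simp: doubleton_eq_iff)
            then have "(x, y) \<in> S (g n (x, y)) n \<and> g n (x, y) < K
                \<or> (x, y) \<in> (S (g n (y, x)) n)\<inverse> \<and> g n (y, x) < K"
              using g(1)[of "(x, y)" n] g(1)[of "(y, x)" n] by (auto simp: S_def K_def)
            then show "(x, y) \<in> step_rel S K n"
              unfolding step_rel_def by blast
          qed
          have Id_V: "Id_on (V n) \<subseteq> step_rel S K n"
            by (simp add: step_rel_def)
          have step_V: "step_rel S K n \<subseteq> V n \<times> V n"
            by (rule uniform_subset[OF uniform_step_rel[OF S_unif]])
          show ?case
          proof clarify
            fix x y assume "(x, y) \<in> gball k n"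
            then have x: "x \<in> V n" and "gdist (E n) x y \<le> enat k"
              by (auto simp: gball_def)
            then obtain j where j: "j \<le> k" "(x, y) \<in> adj (E n) ^^ j"
              by (auto simp: gdist_le_iff)
            have "gdist ?F x y \<le> enat (j * L)"
              using elim by (intro gdist_relpow[OF _ j(2)]) auto
            then obtain i where i: "i \<le> j * L" "(x, y) \<in> adj ?F ^^ i"
              by (auto simp: gdist_le_iff)
            have "(x, y) \<in> step_rel S K n ^^ i"
              using relpow_subset_relpow[OF adj_F] i(2) by blast
            moreover have "(x, x) \<in> step_rel S K n"
              using Id_V x by auto
            ultimately have "(x, y) \<in> step_rel S K n ^^ Suc i"
              by (rule relpow_Suc_I2[rotated])
            moreover have "i \<le> k * L"
              using i(1) j(1) by (meson mult_le_mono1 order_trans)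
            ultimately show "(x, y) \<in> step_rel S K n ^^ Suc (k * L)"
              using relpow_Suc_mono_refl[OF subset_refl step_V Id_V] by blast
          qed
        qed
        then have "internal (gball k) \<subseteq> internal (\<lambda>n. step_rel S K n ^^ Suc (k * L))"
          by (simp only: internal_subset_iff[OF uniform_subset[OF uniform_gball]])
        also have "\<dots> = internal (step_rel S K) ^^ Suc (k * L)"
          by (rule internal_relpow[OF uniform_subset[OF uniform_step_rel[OF S_unif]]])
        also have "\<dots> \<subseteq> R"
          by (rule step)
        finally show ?thesis .
      qed
      then show "p \<in> R" if "p \<in> groupoid" for p
        using that unfolding groupoid_eq by blast
    qed
  qed
  then have generating: "generating units (completion loeb) (\<lambda>i. internal (S i))"
    by (simp add: generating_def space_loeb)
  have "graphing_cost (completion loeb) (\<lambda>i. internal (S i)) = (\<Sum>i. mass (S i))"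
    by (simp add: graphing_cost_def emeasure_internal S_unif)
  also have "\<dots> = (\<Sum>i<K. mass (S i))"
  proof (rule suminf_finite)
    fix i assume "i \<notin> {..<K}"
    then have "S i = (\<lambda>n. {})"
      using g(1) by (fastforce simp: S_def K_def)
    then show "mass (S i) = 0"
      by (simp add: mass_empty)
  qed simp
  also have "\<dots> \<le> c"
  proof (rule tendsto_upperbound[OF _ _ U_neq_bot])
    show "((\<lambda>n. \<Sum>i<K. density (S i) n) \<longlongrightarrow> (\<Sum>i<K. mass (S i))) U"
      by (intro tendsto_sum mass_tendsto)
    have "(\<Sum>i<K. density (S i) n) = density Q n" for n
    proof -
      have "Q n = (\<Union>i<K. S i n)"
        using g(1) by (auto simp: S_def K_def)
      then have "card (Q n) = card (\<Union>i<K. S i n)"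
        by simp
      also have "\<dots> = (\<Sum>i<K. card (S i n))"
        using finQ by (intro card_UN_disjoint) (auto simp: S_def)
      finally show ?thesis
        by (simp add: sum_ennreal sum_divide_distrib)
    qed
    then show "eventually (\<lambda>n. (\<Sum>i<K. density (S i) n) \<le> c) U"
      using density by simp
  qed
  finally show ?thesis
    unfolding ultra_groupoid_cost_def cost_def ultra_groupoid_measure_eq
    using graphing generating by (intro INF_lower2) auto
qed

lemma ultra_groupoid_cost_le:
  assumes "eventually (\<lambda>n. cost_at_scale L (V n) (E n) < c) U"
  shows "ultra_groupoid_cost U V E \<le> c"
proof -
  \<comment> \<open>Containment in the ball is demanded even at indices where the cost is not below
    \<open>c\<close>, because uniform relations are bounded at every \<open>n\<close>. Elsewhere the
    strict bound on the infimum is witnessed by an actual graph.\<close>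
  have "\<exists>Q. Q \<subseteq> gball L n \<and> (cost_at_scale L (V n) (E n) < c \<longrightarrow>
      ennreal (real (card Q) / real (card (V n))) \<le> c
      \<and> (\<forall>x y. {x, y} \<in> E n \<longrightarrow> gdist ((\<lambda>(x, y). {x, y}) ` Q) x y \<le> enat L))" for n
  proof (cases "cost_at_scale L (V n) (E n) < c")
    case True
    then obtain F where F: "finite_graph (V n) F" "lipschitz_equivalent L (E n) F"
      and c: "ennreal (real (card F) / real (card (V n))) < c"
      unfolding cost_at_scale_def INF_less_iff by blast
    obtain Q where Q: "Q \<subseteq> V n \<times> V n" "inj_on (\<lambda>(x, y). {x, y}) Q" "F = (\<lambda>(x, y). {x, y}) ` Q"
      using finite_graph_ex_orientation[OF F(1)] by blast
    have "card F = card Q"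
      unfolding Q(3) by (rule card_image[OF Q(2)])
    moreover have "gdist (E n) x y \<le> enat L" if "(x, y) \<in> Q" for x y
    proof -
      have "{x, y} \<in> F"
        unfolding Q(3) using that by (rule rev_image_eqI) simp
      then show ?thesis
        using F(2) by (simp add: lipschitz_equivalent_def)
    qed
    ultimately show ?thesis
      using Q F(2) c by (intro exI[of _ Q]) (auto simp: gball_def lipschitz_equivalent_def)
  qed auto
  then obtain Q where Q: "\<And>n. Q n \<subseteq> gball L n"
    and good: "\<And>n. cost_at_scale L (V n) (E n) < c \<Longrightarrow> density Q n \<le> c
      \<and> (\<forall>x y. {x, y} \<in> E n \<longrightarrow> gdist ((\<lambda>(x, y). {x, y}) ` Q n) x y \<le> enat L)"
    by metis
  have "eventually (\<lambda>n. density Q n \<le> c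
      \<and> (\<forall>x y. {x, y} \<in> E n \<longrightarrow> gdist ((\<lambda>(x, y). {x, y}) ` Q n) x y \<le> enat L)) U"
    using assms by (rule eventually_mono) (rule good)
  then show ?thesis
    unfolding eventually_conj_iff using Q by (intro ultra_groupoid_cost_le_of_relations[of Q L]) auto
qed

end

section \<open>Lower limits as infima over ultrafilters\<close>

theorem corollary1p3:
  fixes V :: "nat \<Rightarrow> 'a set" and E :: "nat \<Rightarrow> 'a set set"
  assumes "\<And>n. finite_graph (V n) (E n)"
    and "bounded_degree V E"
  shows "combinatorial_cost V E
    = (INF U\<in>{U. nonprincipal_ultrafilter U}. ultra_groupoid_cost U V E)"
proof (rule antisym)
  have seq: "ultra_graph_sequence U V E" if "nonprincipal_ultrafilter U" for U
    using assms that by (simp add: ultra_graph_sequence_def)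
  show "combinatorial_cost V E
      \<le> (INF U\<in>{U. nonprincipal_ultrafilter U}. ultra_groupoid_cost U V E)"
    using ultra_graph_sequence.combinatorial_cost_le_ultra_groupoid_cost[OF seq]
    by (intro INF_greatest) simp
  show "(INF U\<in>{U. nonprincipal_ultrafilter U}. ultra_groupoid_cost U V E) \<le> combinatorial_cost V E"
    unfolding combinatorial_cost_def
  proof (rule INF_greatest, rule dense_ge)
    fix L c
    assume less: "liminf (\<lambda>n. cost_at_scale L (V n) (E n)) < c"
    \<comment> \<open>The ultrafilter depends on \<open>L\<close> and \<open>c\<close>: infinitely
      many indices have cost below \<open>c\<close>, and some non-principal ultrafilter contains the
      set of them. As \<open>c\<close> is any value above the lower limit, this suffices.\<close>
    have "infinite {n. cost_at_scale L (V n) (E n) < c}"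
    proof
      assume "finite {n. cost_at_scale L (V n) (E n) < c}"
      then have "eventually (\<lambda>n. c \<le> cost_at_scale L (V n) (E n)) sequentially"
        by (simp add: eventually_cofinite not_le flip: cofinite_eq_sequentially)
      then have "c \<le> liminf (\<lambda>n. cost_at_scale L (V n) (E n))"
        by (rule Liminf_bounded)
      with less show False by simp
    qed
    then obtain U where U: "nonprincipal_ultrafilter U"
        "eventually (\<lambda>n. n \<in> {n. cost_at_scale L (V n) (E n) < c}) U"
      using ex_nonprincipal_ultrafilter by blast
    then have "ultra_groupoid_cost U V E \<le> c"
      by (intro ultra_graph_sequence.ultra_groupoid_cost_le[OF seq]) auto
    with U(1) show "(INF U\<in>{U. nonprincipal_ultrafilter U}. ultra_groupoid_cost U V E) \<le> c"
      by (intro INF_lower2) auto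
  qed
qed

end
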